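(* Let $M,N\ge1$, let $p\ge1$ be an integer, let $E\subset\mathfrak{LC}_p(\mathbb R^M,\mathbb R^N)$, let $\Theta,\widehat\Theta$ be any pair of suitable sets of moduli of continuity with $\theta^I_j\le\hat\theta^I_j$ for all $I,j$, and let $D\subset\mathbb R^M$ and $D'\subset\mathbb R^N$ be any countable dense subsets. Then: (i) If $E$ has $L^p_{loc}$-bounded $l$-bounds and $\mathcal T_1,\mathcal T_2$ is any pair of the strong topologies listed in the context, then $$(E,\mathcal T_1)=(E,\mathcal T_2)\quad\text{and}\quad \mathrm{cls}_{(\mathfrak{SC}_p(\mathbb R^M,\mathbb R^N),\mathcal T_1)}(E)=\mathrm{cls}_{(\mathfrak{SC}_p(\mathbb R^M,\mathbb R^N),\mathcal T_2)}(E).$$ (ii) If $E$ has $L^1_{loc}$-bounded $l$-bounds and $\mathcal T_1,\mathcal T_2$ is any pair of the weak topologies listed in the context, then $$(E,\mathcal T_1)=(E,\mathcal T_2)\quad\text{and}\quad \mathrm{cls}_{(\mathfrak{SC}(\mathbb R^M,\mathbb R^N),\mathcal T_1)}(E)=\mathrm{cls}_{(\mathfrak{SC}(\mathbb R^M,\mathbb R^N),\mathcal T_2)}(E).$$ Here $(E,\mathcal T_1)=(E,\mathcal T_2)$ means that the two topologies induced on $E$ coincide, and $\mathrm{cls}$ denotes topological closure.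
   Context: $B_j$ is the closed ball of radius $j$ centered at the origin; $C(I,W)$ is the space of continuous functions $I\to W$. $L^p_{loc}$ is the set of real functions on $\mathbb R$ belonging to $L^p(I)$ for every compact interval $I$. $\mathfrak{SC}_p(\mathbb R^{M},\mathbb R^N)$ is the set of functions $f:\mathbb R\times\mathbb R^{M}\to\mathbb R^N$ such that: $f$ is Borel measurable; for every compact $K\subset\mathbb R^{M}$ there is $m^K\in L^p_{loc}$ such that for a.e. $t\in\mathbb R$, $|f(t,x)|\le m^K(t)$ for all $x\in K$; and for a.e. $t\in\mathbb R$, $f(t,\cdot)$ is continuous. $\mathfrak{LC}_p(\mathbb R^{M},\mathbb R^N)\subset\mathfrak{SC}_p(\mathbb R^{M},\mathbb R^N)$ is the subset of those $f$ such that for every compact $K$ there is $l^K\in L^p_{loc}$ such that for a.e. $t$, $|f(t,x_1)-f(t,x_2)|\le l^K(t)|x_1-x_2|$ for all $x_1,x_2\in K$. Functions differing only on a negligible set are identified. The subscript is omitted when $p=1$. The optimal $l$-bound of $f$ on $B_j\subset\mathbb R^M$ is $l^j(t)=\sup_{x_1\ne x_2\in B_j}|f(t,x_1)-f(t,x_2)|/|x_1-x_2|$. For $q\in\{1,p\}$, $E$ has $L^q_{loc}$-bounded $l$-bounds if for every $j\in\mathbb N$ and $r>0$ one has $\sup_{f\in E}\int_{-r}^r l_f^j(t)^q\,dt<\infty$, where $l^j_f$ is the optimal $l$-bound of $f$ on $B_j$. A suitable set of moduli of continuity is a countable set $\Theta=\{\theta^I_j: j\in\mathbb N,\ I=[q_1,q_2],\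 q_1,q_2\in\mathbb Q\}$ of non-decreasing continuous functions $[0,\infty)\to[0,\infty)$ with $\theta^I_j(0)=0$ and $\theta^{I_1}_{j_1}\le\theta^{I_2}_{j_2}$ whenever $I_1\subseteq I_2$, $j_1\le j_2$. $\mathcal K^I_j$ (resp. $\widehat{\mathcal K}^I_j$) denotes the set of $x\in C(I,B_j)$ with $|x(t)-x(s)|\le\theta^I_j(|t-s|)$ (resp. $\hat\theta^I_j(|t-s|)$) on $I$; here $B_j\subset\mathbb R^M$ for the topologies $\mathcal T_B,\mathcal T_\Theta,\sigma_\Theta$, and $B_j\subset\mathbb R^N$ for the hybrid ones. Each topology is generated by the indicated seminorms, over all $I=[q_1,q_2]$ with rational endpoints and $j\in\mathbb N$ ($I-1$ denotes the translate of $I$). The hybrid topologies are considered only when $M=2N$, points of $\mathbb R^{2N}$ being written $(x,u)$. Strong topologies on $\mathfrak{SC}_p(\mathbb R^M,\mathbb R^N)$: - $\mathcal T_B$: $\sup_{x\in C(I,B_j)}[\int_I|f(t,x(t))|^pdt]^{1/p}$; - $\mathcal T_D$: $[\int_I|f(t,x)|^pdt]^{1/p}$, $x\in D$; - $\mathcal T_\Theta$: $\sup_{x\in\mathcal K^I_j}[\int_I|f(t,x(t))|^pdt]^{1/p}$; - (hybrid) $\mathcal T_{\Theta D'}$: $\sup_{x\in\mathcal K^I_j}[\int_I|f(t,x(t),u)|^pdt]^{1/p}$, $u\in D'$; - (hybrid) $\mathcal T_{\Theta\widehat\Theta}$: $\sup_{x\in\mathcal K^I_j,u\in\widehat{\mathcal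 K}^{I-1}_j}[\int_I|f(t,x(t),u(t-1))|^pdt]^{1/p}$, and $\mathcal T_{\Theta\Theta}$, the case $\widehat\Theta=\Theta$; - (hybrid) $\mathcal T_{\Theta B}$: $\sup_{x\in\mathcal K^I_j,u\in C(I-1,B_j)}[\int_I|f(t,x(t),u(t-1))|^pdt]^{1/p}$. Weak topologies on $\mathfrak{SC}(\mathbb R^M,\mathbb R^N)$: - $\sigma_D$: $|\int_If(t,x)dt|$, $x\in D$; - $\sigma_\Theta$: $\sup_{x\in\mathcal K^I_j}|\int_If(t,x(t))dt|$; - (hybrid) $\sigma_{\Theta D'}$: $\sup_{x\in\mathcal K^I_j}|\int_If(t,x(t),u)dt|$, $u\in D'$; - (hybrid) $\sigma_{\Theta\widehat\Theta}$: $\sup_{x\in\mathcal K^I_j,u\in\widehat{\mathcal K}^{I-1}_j}|\int_If(t,x(t),u(t-1))dt|$, and $\sigma_{\Theta\Theta}$, the case $\widehat\Theta=\Theta$. *)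

theory Defs
  imports "HOL-Analysis.Analysis"
begin

section \<open>Caratheodory functions\<close>

definition Lp_loc :: "nat \<Rightarrow> (real \<Rightarrow> real) set" where
  "Lp_loc p = {m. m \<in> borel_measurable lebesgue \<and>
     (\<forall>a b. set_integrable lebesgue {a..b} (\<lambda>t. \<bar>m t\<bar> ^ p))}"

definition SC_fun :: "nat \<Rightarrow> (real \<times> (real^'m) \<Rightarrow> real^'n) set" where
  "SC_fun p = {f. f \<in> borel_measurable borel \<and>
     (\<forall>K. compact K \<longrightarrow>
        (\<exists>m\<in>Lp_loc p. AE t in lebesgue. \<forall>x\<in>K. norm (f (t, x)) \<le> m t)) \<and>
     (AE t in lebesgue. continuous_on UNIV (\<lambda>x. f (t, x)))}"

definition LC_fun :: "nat \<Rightarrow> (real \<times> (real^'m) \<Rightarrow> real^'n) set" where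
  "LC_fun p = {f \<in> SC_fun p.
     \<forall>K. compact K \<longrightarrow>
        (\<exists>l\<in>Lp_loc p. AE t in lebesgue.
           \<forall>x1\<in>K. \<forall>x2\<in>K. norm (f (t, x1) - f (t, x2)) \<le> l t * norm (x1 - x2))}"

text \<open>
  Functions that differ only on a negligible set are identified, so the spaces proper
  consist of equivalence classes.  The classes are formed inside \<open>SC_fun 1\<close>, which contains
  \<open>SC_fun p\<close> for every \<open>p \<ge> 1\<close>; a class is then literally the same object for all exponents.
\<close>

definition SC_class :: "(real \<times> (real^'m) \<Rightarrow> real^'n) \<Rightarrow> (real \<times> (real^'m) \<Rightarrow> real^'n) set" where
  "SC_class f = {g \<in> SC_fun 1. negligible {z. f z \<noteq> g z}}"

definition SC :: "nat \<Rightarrow> (real \<times> (real^'m) \<Rightarrow> real^'n) set set" where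
  "SC p = SC_class ` SC_fun p"

definition LC :: "nat \<Rightarrow> (real \<times> (real^'m) \<Rightarrow> real^'n) set set" where
  "LC p = SC_class ` LC_fun p"

text \<open>
  By the lemma below, two members of a class satisfy \<open>f (t, x) = g (t, x)\<close> for all \<open>x\<close> at once,
  for almost every \<open>t\<close>.  Hence the optimal l-bounds (up to null sets), the integrals along curves
  and membership in \<open>SC_fun p\<close> or \<open>LC_fun p\<close> do not depend on the chosen representative.
\<close>

lemma SC_class_AE_eq:
  fixes f g :: "real \<times> (real^'m) \<Rightarrow> real^'n"
  assumes f: "f \<in> SC_fun p" and g: "g \<in> SC_fun q" and fg: "negligible {z. f z \<noteq> g z}"
  shows "AE t in lebesgue. \<forall>x. f (t, x) = g (t, x)"
proof -
  have "AE z in lebesgue. f z = g z"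
    using fg by (simp add: negligible_iff_null_sets eventually_ae_filter) blast
  then have "AE z in lborel. f z = g z"
    by (simp add: AE_completion_iff)
  then have "AE z in (lborel \<Otimes>\<^sub>M lborel). f z = g z"
    by (subst lborel_prod)
  then have "AE t in lborel. AE x in lborel. f (t, x) = g (t, x)"
    by (rule lborel_pair.AE_pair)
  moreover have "AE t in lborel. continuous_on UNIV (\<lambda>x. f (t, x))"
    using f by (simp add: SC_fun_def AE_completion_iff)
  moreover have "AE t in lborel. continuous_on UNIV (\<lambda>x. g (t, x))"
    using g by (simp add: SC_fun_def AE_completion_iff)
  ultimately have "AE t in lborel. \<forall>x. f (t, x) = g (t, x)"
  proof eventually_elim
    case (elim t)
    let ?U = "{x. f (t, x) \<noteq> g (t, x)}"
    have "open ?U"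
      using elim(2,3) by (rule open_Collect_neq)
    moreover have "negligible ?U"
      using AE_completion[OF elim(1)] by (simp add: negligible_iff_null_sets AE_iff_null_sets
          \<open>open ?U\<close> borel_open)
    ultimately have "?U = {}"
      using open_not_negligible by blast
    then show ?case by blast
  qed
  then show ?thesis
    by (rule AE_completion)
qed

definition repr :: "(real \<times> (real^'m) \<Rightarrow> real^'n) set \<Rightarrow> real \<times> (real^'m) \<Rightarrow> real^'n" where
  "repr F = (SOME f. f \<in> F)"


section \<open>Optimal l-bounds\<close>

text \<open>Extended values: for exceptional \<open>t\<close> the difference quotients may be unbounded.\<close>

definition opt_lbound :: "(real \<times> (real^'m) \<Rightarrow> real^'n) \<Rightarrow> nat \<Rightarrow> real \<Rightarrow> ennreal" where
  "opt_lbound f j t =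
     (SUP (x1, x2) \<in> {(x1, x2). x1 \<in> cball 0 (real j) \<and> x2 \<in> cball 0 (real j) \<and> x1 \<noteq> x2}.
        ennreal (norm (f (t, x1) - f (t, x2)) / norm (x1 - x2)))"

definition Lq_loc_bounded_lbounds :: "nat \<Rightarrow> (real \<times> (real^'m) \<Rightarrow> real^'n) set set \<Rightarrow> bool" where
  "Lq_loc_bounded_lbounds q E \<longleftrightarrow>
     (\<forall>j. \<forall>r>0. (SUP F\<in>E. set_nn_integral lebesgue {-r..r}
                            (\<lambda>t. opt_lbound (repr F) j t ^ q)) < \<infinity>)"


section \<open>Moduli of continuity\<close>

definition rat_intervals :: "real set set" where
  "rat_intervals = {{q1..q2} | q1 q2. q1 \<in> \<rat> \<and> q2 \<in> \<rat> \<and> q1 \<le> q2}"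

definition suitable_moduli :: "(real set \<Rightarrow> nat \<Rightarrow> real \<Rightarrow> real) \<Rightarrow> bool" where
  "suitable_moduli \<theta> \<longleftrightarrow>
     (\<forall>I\<in>rat_intervals. \<forall>j.
        mono_on {0..} (\<theta> I j) \<and> continuous_on {0..} (\<theta> I j) \<and> \<theta> I j 0 = 0) \<and>
     (\<forall>I1\<in>rat_intervals. \<forall>I2\<in>rat_intervals. \<forall>j1 j2.
        I1 \<subseteq> I2 \<and> j1 \<le> j2 \<longrightarrow> (\<forall>s\<ge>0. \<theta> I1 j1 s \<le> \<theta> I2 j2 s))"

text \<open>
  Elements of \<open>C(I, B\<^sub>j)\<close> are represented by functions on the whole line of which only the
  restriction to \<open>I\<close> is ever used.
\<close>

definition C_ball :: "real set \<Rightarrow> nat \<Rightarrow> (real \<Rightarrow> 'a::real_normed_vector) set" where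
  "C_ball I j = {x. continuous_on I x \<and> x ` I \<subseteq> cball 0 (real j)}"

definition K_mod ::
    "(real set \<Rightarrow> nat \<Rightarrow> real \<Rightarrow> real) \<Rightarrow> real set \<Rightarrow> nat \<Rightarrow> (real \<Rightarrow> 'a::real_normed_vector) set" where
  "K_mod \<theta> I j = {x \<in> C_ball I j. \<forall>t\<in>I. \<forall>s\<in>I. norm (x t - x s) \<le> \<theta> I j \<bar>t - s\<bar>}"


section \<open>Topologies generated by seminorms\<close>

text \<open>
  All the seminorms have the same shape: for an interval \<open>I\<close> and a set \<open>\<Gamma>\<close> of curves, the supremum
  over \<open>\<gamma> \<in> \<Gamma>\<close> of the size of \<open>t \<mapsto> f (t, \<gamma> t)\<close> on \<open>I\<close>.  A topology is therefore given by a
  family of pairs \<open>(I, \<Gamma>)\<close>; pointwise seminorms correspond to a single constant curve.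
\<close>

definition strong_seminorm ::
    "nat \<Rightarrow> real set \<times> (real \<Rightarrow> real^'m) set \<Rightarrow> (real \<times> (real^'m) \<Rightarrow> real^'n) \<Rightarrow> real" where
  "strong_seminorm p = (\<lambda>(I, \<Gamma>) f.
     SUP \<gamma>\<in>\<Gamma>. (LINT t:I|lebesgue. norm (f (t, \<gamma> t)) ^ p) powr (1 / real p))"

definition weak_seminorm ::
    "real set \<times> (real \<Rightarrow> real^'m) set \<Rightarrow> (real \<times> (real^'m) \<Rightarrow> real^'n) \<Rightarrow> real" where
  "weak_seminorm = (\<lambda>(I, \<Gamma>) f. SUP \<gamma>\<in>\<Gamma>. norm (LINT t:I|lebesgue. f (t, \<gamma> t)))"

definition seminorm_topology ::
    "(real \<times> (real^'m) \<Rightarrow> real^'n) set set \<Rightarrow> ((real \<times> (real^'m) \<Rightarrow> real^'n) \<Rightarrow> real) set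
      \<Rightarrow> (real \<times> (real^'m) \<Rightarrow> real^'n) set topology" where
  "seminorm_topology X P = topology_generated_by
     {{G \<in> X. \<rho> (\<lambda>z. repr G z - repr F z) < \<epsilon>} | F \<rho> \<epsilon>. F \<in> X \<and> \<rho> \<in> P \<and> \<epsilon> > 0}"

definition strong_topology ::
    "nat \<Rightarrow> (real set \<times> (real \<Rightarrow> real^'m) set) set \<Rightarrow> (real \<times> (real^'m) \<Rightarrow> real^'n) set topology" where
  "strong_topology p \<C> = seminorm_topology (SC p) (strong_seminorm p ` \<C>)"

definition weak_topology ::
    "(real set \<times> (real \<Rightarrow> real^'m) set) set \<Rightarrow> (real \<times> (real^'m) \<Rightarrow> real^'n) set topology" where
  "weak_topology \<C> = seminorm_topology (SC 1) (weak_seminorm ` \<C>)"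

definition curves_B :: "(real set \<times> (real \<Rightarrow> real^'m) set) set" where
  "curves_B = {(I, C_ball I j) | I j. I \<in> rat_intervals}"

definition curves_D :: "(real^'m) set \<Rightarrow> (real set \<times> (real \<Rightarrow> real^'m) set) set" where
  "curves_D D = {(I, {\<lambda>t. x}) | I x. I \<in> rat_intervals \<and> x \<in> D}"

definition curves_Theta ::
    "(real set \<Rightarrow> nat \<Rightarrow> real \<Rightarrow> real) \<Rightarrow> (real set \<times> (real \<Rightarrow> real^'m) set) set" where
  "curves_Theta \<theta> = {(I, K_mod \<theta> I j) | I j. I \<in> rat_intervals}"

text \<open>
  Hybrid topologies.  A bijection \<open>e\<close> from \<open>'n + 'n\<close> onto \<open>'m\<close> (which exists iff \<open>M = 2 N\<close>) says
  which coordinates of a point of \<open>real^'m\<close> form its first and which its second component;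
  \<open>pt e x u\<close> is the point written \<open>(x, u)\<close>.
\<close>

definition pt :: "('n::finite + 'n \<Rightarrow> 'm) \<Rightarrow> real^'n \<Rightarrow> real^'n \<Rightarrow> real^'m" where
  "pt e x u = (\<chi> i. case inv e i of Inl k \<Rightarrow> x $ k | Inr k \<Rightarrow> u $ k)"

abbreviation shift_back :: "real set \<Rightarrow> real set" where
  "shift_back I \<equiv> (\<lambda>t. t - 1) ` I"

definition curves_Theta_D ::
    "('n::finite + 'n \<Rightarrow> 'm) \<Rightarrow> (real set \<Rightarrow> nat \<Rightarrow> real \<Rightarrow> real) \<Rightarrow> (real^'n) set
      \<Rightarrow> (real set \<times> (real \<Rightarrow> real^'m) set) set" where
  "curves_Theta_D e \<theta> D' =
     {(I, {\<lambda>t. pt e (x t) u | x. x \<in> K_mod \<theta> I j}) | I j u. I \<in> rat_intervals \<and> u \<in> D'}"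

definition curves_Theta_Theta ::
    "('n::finite + 'n \<Rightarrow> 'm) \<Rightarrow> (real set \<Rightarrow> nat \<Rightarrow> real \<Rightarrow> real) \<Rightarrow> (real set \<Rightarrow> nat \<Rightarrow> real \<Rightarrow> real)
      \<Rightarrow> (real set \<times> (real \<Rightarrow> real^'m) set) set" where
  "curves_Theta_Theta e \<theta> \<theta>' =
     {(I, {\<lambda>t. pt e (x t) (u (t - 1)) | x u. x \<in> K_mod \<theta> I j \<and> u \<in> K_mod \<theta>' (shift_back I) j})
       | I j. I \<in> rat_intervals}"

definition curves_Theta_B ::
    "('n::finite + 'n \<Rightarrow> 'm) \<Rightarrow> (real set \<Rightarrow> nat \<Rightarrow> real \<Rightarrow> real) \<Rightarrow> (real set \<times> (real \<Rightarrow> real^'m) set) set" where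
  "curves_Theta_B e \<theta> =
     {(I, {\<lambda>t. pt e (x t) (u (t - 1)) | x u. x \<in> K_mod \<theta> I j \<and> u \<in> C_ball (shift_back I) j})
       | I j. I \<in> rat_intervals}"

definition strong_topologies ::
    "('n::finite + 'n \<Rightarrow> 'm) \<Rightarrow> nat \<Rightarrow> (real set \<Rightarrow> nat \<Rightarrow> real \<Rightarrow> real) \<Rightarrow> (real set \<Rightarrow> nat \<Rightarrow> real \<Rightarrow> real)
      \<Rightarrow> (real^'m) set \<Rightarrow> (real^'n) set \<Rightarrow> (real \<times> (real^'m) \<Rightarrow> real^'n) set topology set" where
  "strong_topologies e p \<theta> \<theta>' D D' = strong_topology p `
     ({curves_B, curves_D D, curves_Theta \<theta>} \<union>
      (if bij e
       then {curves_Theta_D e \<theta> D', curves_Theta_Theta e \<theta> \<theta>', curves_Theta_Theta e \<theta> \<theta>,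
             curves_Theta_B e \<theta>}
       else {}))"

definition weak_topologies ::
    "('n::finite + 'n \<Rightarrow> 'm) \<Rightarrow> (real set \<Rightarrow> nat \<Rightarrow> real \<Rightarrow> real) \<Rightarrow> (real set \<Rightarrow> nat \<Rightarrow> real \<Rightarrow> real)
      \<Rightarrow> (real^'m) set \<Rightarrow> (real^'n) set \<Rightarrow> (real \<times> (real^'m) \<Rightarrow> real^'n) set topology set" where
  "weak_topologies e \<theta> \<theta>' D D' = weak_topology `
     ({curves_D D, curves_Theta \<theta>} \<union>
      (if bij e
       then {curves_Theta_D e \<theta> D', curves_Theta_Theta e \<theta> \<theta>', curves_Theta_Theta e \<theta> \<theta>}
       else {}))"

end

(*
  Every topology in the two lists dominates the topology of pointwise seminorms over a dense set
  of constant curves, so it suffices to bound, for a fixed F in the big space and uniformly over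
  G in E, a seminorm of G - F by finitely many pointwise seminorms of G - F.

  A curve is replaced by a curve with values in a finite subset of the dense set.  The error in G
  is controlled by the bounded l-bounds; the error in F tends to zero by dominated convergence,
  because F is continuous in x and locally dominated.  Hence no Lipschitz bound for F is
  needed, and the same estimate yields both the induced topologies on E and the closures.
  In the strong case the finite-valued curve may be any measurable selection, since the absolute
  value is under the integral, so no equicontinuity is needed.  In the weak case the curve must be
  constant on the pieces of a partition of I chosen independently of the curve, which is where
  the moduli of continuity enter.
*)
theory Submission
  imports Defs
begin

section \<open>Comparison of topologies generated by seminorms\<close>

text \<open>Differences \<open>G - F\<close> are controlled only for \<open>G\<close> in
  \<open>E\<close>, so what can be compared are not the topologies of the big space but traces: a
  neighbourhood \<open>U\<close> of \<open>F\<close> in one topology is matched by a neighbourhood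
  \<open>V\<close> in the other with \<open>V \<inter> E \<subseteq> U\<close>.

  What a family of curves must provide is isolated in conditions (\<open>bounded_pair\<close>,
  \<open>dense_constants\<close>, and in the weak case \<open>equicontinuous_pair\<close>). They are
  the same for both families, so one argument covers every pair in a list. The dense set of
  constants varies with the family: it is \<open>D\<close>, the whole space, or all pairs
  \<open>(x, u)\<close> with \<open>u \<in> D'\<close>.

  Two obstacles shape the estimates. A dense set may miss a small ball, in the extreme case the ball
  of radius 0, so the finite nets and the l-bounds for the ball of index \<open>j\<close> are taken
  in the ball of index \<open>Suc j\<close>. And the root in the strong seminorms does not go well
  with sums of integrals, so all estimates are made for p-th powers; roots return only when these
  are translated back into seminorms.\<close>

lemma topspace_seminorm_topology_subset: "topspace (seminorm_topology X P) \<subseteq> X"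
  by (auto simp: seminorm_topology_def topology_generated_by_topspace)

lemma openin_seminorm_ball:
  assumes "F \<in> X" "\<rho> \<in> P" "\<epsilon> > 0"
  shows "openin (seminorm_topology X P) {G \<in> X. \<rho> (\<lambda>z. repr G z - repr F z) < \<epsilon>}"
  unfolding seminorm_topology_def using assms
  by (intro topology_generated_by_Basis) blast

text \<open>The topology is generated by balls around all points of \<open>X\<close>, while
  \<open>approx\<close> speaks about differences with the given \<open>F\<close>; \<open>tri\<close>
  recentres a ball at \<open>F\<close>. Induction over the generation of \<open>U\<close> reduces
  the claim to one such ball, with \<open>F\<close> fixed throughout.\<close>

lemma seminorm_topology_refine:
  assumes "P \<noteq> {}"
    and tri: "\<And>\<rho> F G H. \<rho> \<in> P \<Longrightarrow> F \<in> X \<Longrightarrow> G \<in> X \<Longrightarrow> H \<in> X \<Longrightarrow>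
      \<rho> (\<lambda>z. repr H z - repr F z) \<le> \<rho> (\<lambda>z. repr H z - repr G z) + \<rho> (\<lambda>z. repr G z - repr F z)"
    and zero: "\<And>\<rho>. \<rho> \<in> Q \<Longrightarrow> \<rho> (\<lambda>z. 0) = 0"
    and "Q \<noteq> {}" and "E \<subseteq> X"
    and approx: "\<And>\<rho> F \<epsilon>. \<rho> \<in> P \<Longrightarrow> F \<in> X \<Longrightarrow> \<epsilon> > 0 \<Longrightarrow>
      \<exists>Q' \<delta>. finite Q' \<and> Q' \<subseteq> Q \<and> \<delta> > (0::real) \<and>
        (\<forall>G\<in>E. (\<forall>\<rho>'\<in>Q'. \<rho>' (\<lambda>z. repr G z - repr F z) < \<delta>) \<longrightarrow> \<rho> (\<lambda>z. repr G z - repr F z) < \<epsilon>)"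
    and U: "openin (seminorm_topology X P) U" "F \<in> U"
  shows "\<exists>V. openin (seminorm_topology X Q) V \<and> F \<in> V \<and> V \<inter> E \<subseteq> U"
proof -
  have "F \<in> X"
    using U openin_subset topspace_seminorm_topology_subset by blast
  have "generate_topology_on {{G \<in> X. \<rho> (\<lambda>z. repr G z - repr F z) < \<epsilon>} | F \<rho> \<epsilon>.
      F \<in> X \<and> \<rho> \<in> P \<and> \<epsilon> > 0} U"
    using U(1) unfolding seminorm_topology_def by (rule openin_topology_generated_by)
  then show ?thesis
    using U(2)
  proof induction
    case Empty
    then show ?case by simp
  next
    case (Int A B)
    then have "F \<in> A" "F \<in> B" by simp_all
    with Int.IH obtain V W where VW: "openin (seminorm_topology X Q) V" "F \<in> V" "V \<inter> E \<subseteq> A"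
      "openin (seminorm_topology X Q) W" "F \<in> W" "W \<inter> E \<subseteq> B"
      by meson
    then have "openin (seminorm_topology X Q) (V \<inter> W)" by (intro openin_Int)
    moreover have "F \<in> V \<inter> W" "V \<inter> W \<inter> E \<subseteq> A \<inter> B" using VW by auto
    ultimately show ?case by meson
  next
    case (UN K)
    then obtain k where k: "k \<in> K" "F \<in> k" by auto
    from UN.IH[OF this] show ?case using k(1) by (meson Union_upper order_trans)
  next
    case (Basis S)
    then obtain F0 \<rho> \<epsilon> where S: "S = {G \<in> X. \<rho> (\<lambda>z. repr G z - repr F0 z) < \<epsilon>}"
      "F0 \<in> X" "\<rho> \<in> P" "\<epsilon> > 0" by blast
    \<comment> \<open>The room left at \<open>F\<close> inside the ball around \<open>F0\<close>;
      positive because \<open>F\<close> lies in \<open>S\<close>.\<close>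
    define r where "r = \<epsilon> - \<rho> (\<lambda>z. repr F z - repr F0 z)"
    have "r > 0" using Basis S by (auto simp: r_def)
    obtain Q' \<delta> where Q': "finite Q'" "Q' \<subseteq> Q" "\<delta> > 0"
      "\<And>G. G \<in> E \<Longrightarrow> \<forall>\<rho>'\<in>Q'. \<rho>' (\<lambda>z. repr G z - repr F z) < \<delta> \<Longrightarrow>
        \<rho> (\<lambda>z. repr G z - repr F z) < r"
      using approx[OF S(3) \<open>F \<in> X\<close> \<open>r > 0\<close>] by blast
    \<comment> \<open>\<open>Q'\<close> may be empty; adding \<open>\<rho>0\<close> keeps the index
      set of the intersection nonempty, so that \<open>V\<close> is open and contained in
      \<open>X\<close>.\<close>
    obtain \<rho>0 where "\<rho>0 \<in> Q" using \<open>Q \<noteq> {}\<close> by blast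
    define V where "V = (\<Inter>\<rho>'\<in>insert \<rho>0 Q'. {G \<in> X. \<rho>' (\<lambda>z. repr G z - repr F z) < \<delta>})"
    have "openin (seminorm_topology X Q) V"
      unfolding V_def using Q' \<open>F \<in> X\<close> \<open>\<rho>0 \<in> Q\<close>
      by (intro openin_INT2) (auto intro: openin_seminorm_ball)
    moreover have "F \<in> V"
      using zero[OF subsetD[OF Q'(2)]] zero[OF \<open>\<rho>0 \<in> Q\<close>] \<open>F \<in> X\<close> Q'(3) by (fastforce simp: V_def)
    moreover have "V \<inter> E \<subseteq> S"
    proof
      fix G assume G: "G \<in> V \<inter> E"
      then have "\<rho> (\<lambda>z. repr G z - repr F z) < r"
        using Q'(4) by (auto simp: V_def)
      moreover have "G \<in> X" using G \<open>E \<subseteq> X\<close> by blast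
      ultimately show "G \<in> S"
        using tri[OF S(3) S(2) \<open>F \<in> X\<close> \<open>G \<in> X\<close>] by (auto simp: S(1) r_def)
    qed
    ultimately show ?case by blast
  qed
qed

text \<open>The carrier is the union of the generating balls, and each \<open>F\<close> in
  \<open>X\<close> lies in the ball around itself because the seminorm vanishes at the zero
  function.\<close>

lemma topspace_seminorm_topology:
  assumes "P \<noteq> {}" and zero: "\<And>\<rho>. \<rho> \<in> P \<Longrightarrow> \<rho> (\<lambda>z. 0) = 0"
  shows "topspace (seminorm_topology X P) = X"
proof
  obtain \<rho> where "\<rho> \<in> P" using assms by blast
  show "X \<subseteq> topspace (seminorm_topology X P)"
  proof
    fix F assume "F \<in> X"
    from openin_subset[OF openin_seminorm_ball[OF this \<open>\<rho> \<in> P\<close>, of 1]]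
    show "F \<in> topspace (seminorm_topology X P)"
      using zero[OF \<open>\<rho> \<in> P\<close>] \<open>F \<in> X\<close> by auto
  qed
qed (rule topspace_seminorm_topology_subset)

text \<open>For the closure, \<open>F\<close> is any point of the carrier: a neighbourhood
  \<open>V\<close> in \<open>T\<close> meets \<open>E\<close>, and by \<open>refine\<close> it does
  so inside \<open>U\<close>. Used in both directions, the lemma gives the two equalities.\<close>

lemma subtopology_closure_of_subset:
  assumes "topspace S = topspace T"
    and refine: "\<And>U F. openin S U \<Longrightarrow> F \<in> U \<Longrightarrow> \<exists>V. openin T V \<and> F \<in> V \<and> V \<inter> E \<subseteq> U"
  shows "\<And>W. openin (subtopology S E) W \<Longrightarrow> openin (subtopology T E) W"
    and "T closure_of E \<subseteq> S closure_of E"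
proof -
  fix W assume "openin (subtopology S E) W"
  then obtain U where U: "openin S U" "W = U \<inter> E"
    by (auto simp: openin_subtopology)
  show "openin (subtopology T E) W"
  proof (subst openin_subopen, intro ballI)
    fix F assume "F \<in> W"
    with refine[OF U(1), of F] U obtain V where "openin T V" "F \<in> V" "V \<inter> E \<subseteq> U" by blast
    with \<open>F \<in> W\<close> U show "\<exists>A. openin (subtopology T E) A \<and> F \<in> A \<and> A \<subseteq> W"
      by (intro exI[of _ "V \<inter> E"]) (auto simp: openin_subtopology)
  qed
next
  show "T closure_of E \<subseteq> S closure_of E"
  proof
    fix F assume F: "F \<in> T closure_of E"
    have "\<exists>y. y \<in> E \<and> y \<in> U" if U: "F \<in> U" "openin S U" for U
    proof -
      obtain V where "openin T V" "F \<in> V" "V \<inter> E \<subseteq> U" using refine[OF U(2,1)] by metis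
      then show ?thesis using F unfolding in_closure_of by blast
    qed
    then show "F \<in> S closure_of E"
      using F assms(1) unfolding in_closure_of by simp
  qed
qed

section \<open>Integrals along measurable curves\<close>

text \<open>A crude substitute for the Minkowski inequality, enough wherever a constant factor is
  harmless; the exact triangle inequality of the seminorms comes later from convexity.\<close>

lemma norm_add_power_le:
  fixes x y :: "'a::real_normed_vector"
  shows "norm (x + y) ^ p \<le> 2 ^ p * (norm x ^ p + norm y ^ p)"
proof -
  have "norm (x + y) ^ p \<le> (2 * max (norm x) (norm y)) ^ p"
    using norm_triangle_ineq[of x y] by (intro power_mono) (auto simp: max_def)
  also have "\<dots> \<le> 2 ^ p * (norm x ^ p + norm y ^ p)"
    by (auto simp: power_mult_distrib max_def)
  finally show ?thesis .
qed

section \<open>Local p-integrability and Caratheodory functions\<close>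

lemma Lp_loc_add:
  assumes "m \<in> Lp_loc p" "l \<in> Lp_loc p"
  shows "(\<lambda>t. m t + l t) \<in> Lp_loc p"
proof -
  have [measurable]: "m \<in> borel_measurable lebesgue" "l \<in> borel_measurable lebesgue"
    using assms by (auto simp: Lp_loc_def)
  have "set_integrable lebesgue {a..b} (\<lambda>t. \<bar>m t + l t\<bar> ^ p)" for a b
  proof (rule set_integrable_bound)
    show "set_integrable lebesgue {a..b} (\<lambda>t. 2 ^ p * (\<bar>m t\<bar> ^ p + \<bar>l t\<bar> ^ p))"
      using assms by (intro set_integrable_mult_right set_integral_add) (auto simp: Lp_loc_def)
    show "AE t in lebesgue. t \<in> {a..b} \<longrightarrow>
        norm (\<bar>m t + l t\<bar> ^ p) \<le> norm (2 ^ p * (\<bar>m t\<bar> ^ p + \<bar>l t\<bar> ^ p))"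
      using norm_add_power_le[of "m _" "l _" p]
      by (intro AE_I2) (simp add: add_nonneg_nonneg)
  qed (unfold set_borel_measurable_def, intro borel_measurable_scaleR borel_measurable_indicator, simp, measurable)
  then show ?thesis by (simp add: Lp_loc_def)
qed

lemma Lp_loc_subset_1:
  assumes "p \<ge> 1"
  shows "Lp_loc p \<subseteq> Lp_loc 1"
proof
  fix m assume m: "m \<in> Lp_loc p"
  then have [measurable]: "m \<in> borel_measurable lebesgue"
    by (auto simp: Lp_loc_def)
  have "set_integrable lebesgue {a..b} (\<lambda>t. \<bar>m t\<bar> ^ 1)" for a b
  proof (rule set_integrable_bound)
    show "set_integrable lebesgue {a..b} (\<lambda>t. 1 + \<bar>m t\<bar> ^ p)"
    proof (rule set_integral_add)
      have "integrable lebesgue (indicat_real {a..b})"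
        by (simp flip: lmeasurable_iff_integrable)
      then show "set_integrable lebesgue {a..b} (\<lambda>t. 1 :: real)"
        by (simp add: set_integrable_def)
    qed (use m in \<open>auto simp: Lp_loc_def\<close>)
    have "\<bar>x\<bar> \<le> 1 + \<bar>x\<bar> ^ p" for x :: real
    proof (cases "\<bar>x\<bar> \<ge> 1")
      case True
      then have "\<bar>x\<bar> \<le> \<bar>x\<bar> ^ p" using self_le_power[of "\<bar>x\<bar>" p] assms by simp
      then show ?thesis by linarith
    next
      case False
      then show ?thesis by (simp add: add_increasing2)
    qed
    then show "AE t in lebesgue. t \<in> {a..b} \<longrightarrow> norm (\<bar>m t\<bar> ^ 1) \<le> norm (1 + \<bar>m t\<bar> ^ p)"
      by (intro AE_I2) (simp add: add_nonneg_nonneg)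
  qed (unfold set_borel_measurable_def, intro borel_measurable_scaleR borel_measurable_indicator, simp, measurable)
  then show "m \<in> Lp_loc 1" by (simp add: Lp_loc_def)
qed

lemma SC_fun_boundE:
  assumes "f \<in> SC_fun p" "compact K"
  obtains m where "m \<in> Lp_loc p" "AE t in lebesgue. \<forall>x\<in>K. norm (f (t, x)) \<le> m t"
proof -
  have "\<exists>m\<in>Lp_loc p. AE t in lebesgue. \<forall>x\<in>K. norm (f (t, x)) \<le> m t"
    using assms(1)[unfolded SC_fun_def] assms(2) by simp
  then show ?thesis using that by (elim bexE)
qed

lemma SC_fun_diff:
  fixes f g :: "real \<times> (real^'m) \<Rightarrow> real^'n"
  assumes f: "f \<in> SC_fun p" and g: "g \<in> SC_fun p"
  shows "(\<lambda>z. f z - g z) \<in> SC_fun p"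
proof -
  have "\<exists>m\<in>Lp_loc p. AE t in lebesgue. \<forall>x\<in>K. norm (f (t, x) - g (t, x)) \<le> m t"
    if K: "compact K" for K
  proof -
    obtain m where m: "m \<in> Lp_loc p" "AE t in lebesgue. \<forall>x\<in>K. norm (f (t, x)) \<le> m t"
      by (rule SC_fun_boundE[OF f K])
    obtain l where l: "l \<in> Lp_loc p" "AE t in lebesgue. \<forall>x\<in>K. norm (g (t, x)) \<le> l t"
      by (rule SC_fun_boundE[OF g K])
    from m(2) l(2) have "AE t in lebesgue. \<forall>x\<in>K. norm (f (t, x) - g (t, x)) \<le> m t + l t"
      by eventually_elim (meson add_mono norm_triangle_ineq4 order_trans)
    then show ?thesis
      using Lp_loc_add[OF m(1) l(1)] by (intro bexI)
  qed
  moreover have "AE t in lebesgue. continuous_on UNIV (\<lambda>x. f (t, x) - g (t, x))"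
  proof -
    have "AE t in lebesgue. continuous_on UNIV (\<lambda>x. f (t, x))"
      "AE t in lebesgue. continuous_on UNIV (\<lambda>x. g (t, x))"
      using f g by (simp_all add: SC_fun_def)
    then show ?thesis by eventually_elim (rule continuous_on_diff)
  qed
  moreover have "(\<lambda>z. f z - g z) \<in> borel_measurable borel"
    using f g by (intro borel_measurable_diff) (simp_all add: SC_fun_def)
  ultimately show ?thesis
    by (simp add: SC_fun_def)
qed

lemma SC_fun_subset_1:
  assumes "p \<ge> 1"
  shows "SC_fun p \<subseteq> SC_fun 1"
proof
  fix f :: "real \<times> (real^'a) \<Rightarrow> real^'b" assume f: "f \<in> SC_fun p"
  have "\<exists>m\<in>Lp_loc 1. AE t in lebesgue. \<forall>x\<in>K. norm (f (t, x)) \<le> m t" if K: "compact K" for K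
    by (rule SC_fun_boundE[OF f K]) (use Lp_loc_subset_1[OF assms] in \<open>intro bexI, auto\<close>)
  then show "f \<in> SC_fun 1"
    using f unfolding SC_fun_def by simp
qed

lemma SC_subset_1:
  assumes "p \<ge> 1"
  shows "SC p \<subseteq> SC 1"
  using SC_fun_subset_1[OF assms] unfolding SC_def by blast

text \<open>Classes are formed inside \<open>SC_fun 1\<close>, so the chosen representative is a
  priori only there. It agrees with a member of \<open>SC_fun p\<close> for almost every
  \<open>t\<close> and all \<open>x\<close> at once, and so inherits the majorants in
  \<open>Lp_loc p\<close>.\<close>

lemma repr_in_SC_fun:
  fixes G :: "(real \<times> (real^'m) \<Rightarrow> real^'n) set"
  assumes "p \<ge> 1" "G \<in> SC p"
  shows "repr G \<in> SC_fun p"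
proof -
  obtain f where f: "f \<in> SC_fun p" "G = SC_class f"
    using assms by (auto simp: SC_def)
  then have "f \<in> G"
    using SC_fun_subset_1[OF assms(1)] by (auto simp: SC_class_def)
  then have "repr G \<in> G"
    unfolding repr_def by (rule someI[of "\<lambda>f. f \<in> G"])
  then have r: "repr G \<in> SC_fun 1" and n: "negligible {z. f z \<noteq> repr G z}"
    by (auto simp: f(2) SC_class_def)
  have eq: "AE t in lebesgue. \<forall>x. f (t, x) = repr G (t, x)"
    using SC_class_AE_eq[OF f(1) r n] .
  have "\<exists>m\<in>Lp_loc p. AE t in lebesgue. \<forall>x\<in>K. norm (repr G (t, x)) \<le> m t" if K: "compact K" for K
  proof -
    obtain m where m: "m \<in> Lp_loc p" and "AE t in lebesgue. \<forall>x\<in>K. norm (f (t, x)) \<le> m t"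
      by (rule SC_fun_boundE[OF f(1) K])
    from eq this(2) have "AE t in lebesgue. \<forall>x\<in>K. norm (repr G (t, x)) \<le> m t"
      by eventually_elim simp
    then show ?thesis using m by (intro bexI)
  qed
  with r show ?thesis by (simp add: SC_fun_def)
qed

text \<open>Continuous curves and finite-valued selections both belong here. The factor
  \<open>indicator I\<close> restricts the measurability requirement to \<open>I\<close>, since
  values outside are arbitrary. It is Borel rather than Lebesgue measurability, so that composing a
  Borel function \<open>f\<close> with the curve stays measurable.\<close>

definition meas_curves :: "real set \<Rightarrow> nat \<Rightarrow> (real \<Rightarrow> real^'m) set" where
  "meas_curves I j = {\<gamma>. (\<lambda>t. indicator I t *\<^sub>R \<gamma> t) \<in> borel_measurable borel \<and> \<gamma> ` I \<subseteq> cball 0 (real j)}"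

lemma C_ball_subset_meas_curves:
  assumes "I \<in> rat_intervals"
  shows "C_ball I j \<subseteq> meas_curves I j"
  using assms
  by (auto simp: C_ball_def meas_curves_def rat_intervals_def intro!: borel_measurable_continuous_on_indicator)

lemma meas_curves_mono: "i \<le> j \<Longrightarrow> meas_curves I i \<subseteq> meas_curves I j"
  by (force simp: meas_curves_def subset_iff)

lemma set_borel_measurable_along:
  fixes f :: "real \<times> (real^'m) \<Rightarrow> real^'n"
  assumes f[measurable]: "f \<in> borel_measurable borel" and g: "\<gamma> \<in> meas_curves I j"
    and I: "I \<in> rat_intervals"
  shows "set_borel_measurable lebesgue I (\<lambda>t. f (t, \<gamma> t))"
proof -
  have [measurable]: "(\<lambda>t. indicator I t *\<^sub>R \<gamma> t) \<in> borel_measurable borel" "I \<in> sets borel"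
    using g I by (auto simp: meas_curves_def rat_intervals_def)
  \<comment> \<open>The inner indicator makes the composition Borel on the whole line; under the
    outer one it does not change the value.\<close>
  have "(\<lambda>t. indicator I t *\<^sub>R f (t, indicator I t *\<^sub>R \<gamma> t)) \<in> borel_measurable lborel"
    by measurable
  then have "(\<lambda>t. indicator I t *\<^sub>R f (t, indicator I t *\<^sub>R \<gamma> t)) \<in> borel_measurable lebesgue"
    by (rule measurable_completion)
  also have "(\<lambda>t. indicator I t *\<^sub>R f (t, indicator I t *\<^sub>R \<gamma> t)) = (\<lambda>t. indicator I t *\<^sub>R f (t, \<gamma> t))"
    by (auto simp: indicator_def)
  finally show ?thesis by (simp add: set_borel_measurable_def)
qed

lemma set_borel_measurable_norm_power:
  fixes g :: "real \<Rightarrow> 'a::{real_normed_vector,second_countable_topology}"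
  assumes "set_borel_measurable M I g" "p \<ge> 1"
  shows "set_borel_measurable M I (\<lambda>t. norm (g t) ^ p)"
proof -
  have [measurable]: "(\<lambda>t. indicator I t *\<^sub>R g t) \<in> borel_measurable M"
    using assms by (simp add: set_borel_measurable_def)
  have "(\<lambda>t. norm (indicator I t *\<^sub>R g t) ^ p) \<in> borel_measurable M" by measurable
  also have "(\<lambda>t. norm (indicator I t *\<^sub>R g t) ^ p) = (\<lambda>t. indicator I t *\<^sub>R norm (g t) ^ p)"
    using assms(2) by (auto simp: indicator_def)
  finally show ?thesis by (simp add: set_borel_measurable_def)
qed

text \<open>One majorant \<open>m\<close> serves all curves in the ball, because the bound of a
  Caratheodory function holds for all \<open>x\<close> of a compact set off a single null set. This
  makes the suprema in the seminorms finite and permits dominated convergence along sequences of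
  varying curves.\<close>

lemma SC_fun_along:
  fixes f :: "real \<times> (real^'m) \<Rightarrow> real^'n"
  assumes f: "f \<in> SC_fun p" and p: "p \<ge> 1" and I: "I \<in> rat_intervals"
  obtains m where "m \<in> Lp_loc p" "set_integrable lebesgue I (\<lambda>t. \<bar>m t\<bar> ^ p)"
    "AE t in lebesgue. \<forall>x\<in>cball 0 (real j). norm (f (t, x)) \<le> m t"
    "\<And>\<gamma>. \<gamma> \<in> meas_curves I j \<Longrightarrow> set_integrable lebesgue I (\<lambda>t. norm (f (t, \<gamma> t)) ^ p)"
    "\<And>\<gamma>. \<gamma> \<in> meas_curves I j \<Longrightarrow>
      (LINT t:I|lebesgue. norm (f (t, \<gamma> t)) ^ p) \<le> (LINT t:I|lebesgue. \<bar>m t\<bar> ^ p)"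
proof -
  obtain m where m: "m \<in> Lp_loc p"
    "AE t in lebesgue. \<forall>x\<in>cball 0 (real j). norm (f (t, x)) \<le> m t"
    by (rule SC_fun_boundE[OF f compact_cball])
  have mi: "set_integrable lebesgue I (\<lambda>t. \<bar>m t\<bar> ^ p)"
    using m(1) I by (auto simp: Lp_loc_def rat_intervals_def)
  have fb: "f \<in> borel_measurable borel" using f by (simp add: SC_fun_def)
  have ae: "AE t in lebesgue. t \<in> I \<longrightarrow> norm (f (t, \<gamma> t)) ^ p \<le> \<bar>m t\<bar> ^ p"
    if "\<gamma> \<in> meas_curves I j" for \<gamma>
    using m(2)
  proof eventually_elim
    case (elim t)
    show ?case
    proof
      assume "t \<in> I"
      then have "norm (f (t, \<gamma> t)) \<le> m t"
        using that elim by (auto simp: meas_curves_def)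
      then show "norm (f (t, \<gamma> t)) ^ p \<le> \<bar>m t\<bar> ^ p"
        by (intro power_mono) auto
    qed
  qed
  have int: "set_integrable lebesgue I (\<lambda>t. norm (f (t, \<gamma> t)) ^ p)" if "\<gamma> \<in> meas_curves I j" for \<gamma>
    using mi
  proof (rule set_integrable_bound)
    show "set_borel_measurable lebesgue I (\<lambda>t. norm (f (t, \<gamma> t)) ^ p)"
      using set_borel_measurable_norm_power[OF set_borel_measurable_along[OF fb that I] p] .
    show "AE t in lebesgue. t \<in> I \<longrightarrow> norm (norm (f (t, \<gamma> t)) ^ p) \<le> norm (\<bar>m t\<bar> ^ p)"
      using ae[OF that] by simp
  qed
  have le: "(LINT t:I|lebesgue. norm (f (t, \<gamma> t)) ^ p) \<le> (LINT t:I|lebesgue. \<bar>m t\<bar> ^ p)"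
    if "\<gamma> \<in> meas_curves I j" for \<gamma>
    using ae[OF that] by (intro set_integral_mono_AE int that mi) auto
  show ?thesis by (rule that[OF m(1) mi m(2) int le])
qed

lemma set_integrable_norm_power:
  fixes f :: "real \<times> (real^'m) \<Rightarrow> real^'n"
  assumes f: "f \<in> SC_fun p" and p: "p \<ge> 1" and I: "I \<in> rat_intervals" and g: "\<gamma> \<in> meas_curves I j"
  shows "set_integrable lebesgue I (\<lambda>t. norm (f (t, \<gamma> t)) ^ p)"
proof (rule SC_fun_along[OF f p I, where j = j])
  assume "\<And>\<gamma>. \<gamma> \<in> meas_curves I j \<Longrightarrow> set_integrable lebesgue I (\<lambda>t. norm (f (t, \<gamma> t)) ^ p)"
  then show ?thesis using g .
qed

section \<open>Approximation by finite-valued curves\<close>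

lemma set_integrable_norm_diff_power:
  fixes f :: "real \<times> (real^'m) \<Rightarrow> real^'n"
  assumes f: "f \<in> SC_fun p" and p: "p \<ge> 1" and I: "I \<in> rat_intervals"
    and g: "\<gamma> \<in> meas_curves I j" and s: "\<sigma> \<in> meas_curves I j"
  shows "set_integrable lebesgue I (\<lambda>t. norm (f (t, \<gamma> t) - f (t, \<sigma> t)) ^ p)"
proof (rule set_integrable_bound)
  show "set_integrable lebesgue I (\<lambda>t. 2 ^ p * (norm (f (t, \<gamma> t)) ^ p + norm (f (t, \<sigma> t)) ^ p))"
    using set_integrable_norm_power[OF f p I g] set_integrable_norm_power[OF f p I s]
    by (intro set_integrable_mult_right set_integral_add)
  have fb: "f \<in> borel_measurable borel" using f by (simp add: SC_fun_def)
  have "set_borel_measurable lebesgue I (\<lambda>t. f (t, \<gamma> t) - f (t, \<sigma> t))"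
    using set_borel_measurable_along[OF fb g I] set_borel_measurable_along[OF fb s I]
    by (simp add: set_borel_measurable_def scaleR_diff_right)
  then show "set_borel_measurable lebesgue I (\<lambda>t. norm (f (t, \<gamma> t) - f (t, \<sigma> t)) ^ p)"
    by (rule set_borel_measurable_norm_power[OF _ p])
  have "norm (f (t, \<gamma> t) - f (t, \<sigma> t)) ^ p \<le> 2 ^ p * (norm (f (t, \<gamma> t)) ^ p + norm (f (t, \<sigma> t)) ^ p)" for t
    using norm_add_power_le[of "f (t, \<gamma> t)" "- f (t, \<sigma> t)" p] by simp
  then show "AE t in lebesgue. t \<in> I \<longrightarrow> norm (norm (f (t, \<gamma> t) - f (t, \<sigma> t)) ^ p) \<le>
      norm (2 ^ p * (norm (f (t, \<gamma> t)) ^ p + norm (f (t, \<sigma> t)) ^ p))"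
    by (intro AE_I2) (simp add: add_nonneg_nonneg)
qed

text \<open>In a sequence of counterexamples the curves need not converge; only the distances within
  the pairs tend to 0. That suffices: for almost every \<open>t\<close> the function
  \<open>f\<close> is uniformly continuous in \<open>x\<close> on the compact ball containing all
  the values, so the integrands tend to 0, and the majorant of \<open>f\<close> on the ball
  dominates them.\<close>

lemma SC_fun_modulus:
  fixes f :: "real \<times> (real^'m) \<Rightarrow> real^'n"
  assumes f: "f \<in> SC_fun p" and p: "p \<ge> 1" and I: "I \<in> rat_intervals" and e: "\<epsilon> > 0"
  shows "\<exists>\<eta>>0. \<forall>\<gamma>\<in>meas_curves I j. \<forall>\<sigma>\<in>meas_curves I j. (\<forall>t\<in>I. norm (\<gamma> t - \<sigma> t) \<le> \<eta>) \<longrightarrow>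
    (LINT t:I|lebesgue. norm (f (t, \<gamma> t) - f (t, \<sigma> t)) ^ p) \<le> \<epsilon>"
proof (rule ccontr)
  assume neg: "\<not> ?thesis"
  define bad where "bad \<eta> \<gamma> \<sigma> \<longleftrightarrow> \<gamma> \<in> meas_curves I j \<and> \<sigma> \<in> meas_curves I j \<and>
      (\<forall>t\<in>I. norm (\<gamma> t - \<sigma> t) \<le> \<eta>) \<and>
      \<epsilon> < (LINT t:I|lebesgue. norm (f (t, \<gamma> t) - f (t, \<sigma> t)) ^ p)" for \<eta> and \<gamma> \<sigma> :: "real \<Rightarrow> real^'m"
  have "\<exists>\<gamma> \<sigma>. bad (inverse (real (Suc n))) \<gamma> \<sigma>" for n
  proof (rule ccontr)
    assume *: "\<not> ?thesis"
    show False
    proof (rule notE[OF neg], rule exI[of _ "inverse (real (Suc n))"], intro conjI ballI impI)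
      fix \<gamma> \<sigma> :: "real \<Rightarrow> real^'m"
      assume a: "\<gamma> \<in> meas_curves I j" "\<sigma> \<in> meas_curves I j"
        "\<forall>t\<in>I. norm (\<gamma> t - \<sigma> t) \<le> inverse (real (Suc n))"
      have "\<not> bad (inverse (real (Suc n))) \<gamma> \<sigma>" using * by simp
      then show "(LINT t:I|lebesgue. norm (f (t, \<gamma> t) - f (t, \<sigma> t)) ^ p) \<le> \<epsilon>"
        unfolding bad_def using a by simp
    qed simp
  qed
  then obtain \<gamma> \<sigma> where bad: "\<And>n. bad (inverse (real (Suc n))) (\<gamma> n) (\<sigma> n)"
    by metis
  then have c: "\<And>n. \<gamma> n \<in> meas_curves I j" "\<And>n. \<sigma> n \<in> meas_curves I j"
    "\<And>n t. t \<in> I \<Longrightarrow> norm (\<gamma> n t - \<sigma> n t) \<le> inverse (real (Suc n))"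
    "\<And>n. \<epsilon> < (LINT t:I|lebesgue. norm (f (t, \<gamma> n t) - f (t, \<sigma> n t)) ^ p)"
    by (simp_all add: bad_def)
  obtain m where m: "set_integrable lebesgue I (\<lambda>t. \<bar>m t\<bar> ^ p)"
    "AE t in lebesgue. \<forall>x\<in>cball 0 (real j). norm (f (t, x)) \<le> m t"
    by (rule SC_fun_along[OF f p I, where j = j]) (rule that)
  have cont: "AE t in lebesgue. continuous_on UNIV (\<lambda>x. f (t, x))"
    using f by (simp add: SC_fun_def)
  have inball: "\<gamma> n t \<in> cball 0 (real j)" "\<sigma> n t \<in> cball 0 (real j)" if "t \<in> I" for n t
    using c(1,2)[of n] that by (auto simp: meas_curves_def simp del: mem_cball)
  have "(\<lambda>n. LINT t|lebesgue. indicator I t *\<^sub>R norm (f (t, \<gamma> n t) - f (t, \<sigma> n t)) ^ p)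
      \<longlonglongrightarrow> integral\<^sup>L (lebesgue :: real measure) (\<lambda>t. 0::real)"
  proof (rule integral_dominated_convergence[where w = "\<lambda>t. indicator I t *\<^sub>R (2 ^ p * (\<bar>m t\<bar> ^ p + \<bar>m t\<bar> ^ p))"])
    show "integrable lebesgue (\<lambda>t. indicator I t *\<^sub>R (2 ^ p * (\<bar>m t\<bar> ^ p + \<bar>m t\<bar> ^ p)))"
      using set_integrable_mult_right[OF set_integral_add(1)[OF m(1) m(1)], of "2 ^ p"]
      by (simp add: set_integrable_def)
    show "(\<lambda>t. indicator I t *\<^sub>R norm (f (t, \<gamma> n t) - f (t, \<sigma> n t)) ^ p) \<in> borel_measurable lebesgue" for n
      using set_integrable_norm_diff_power[OF f p I c(1,2)]
      unfolding set_integrable_def by (rule borel_measurable_integrable)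
    show "AE t in lebesgue. norm (indicator I t *\<^sub>R norm (f (t, \<gamma> n t) - f (t, \<sigma> n t)) ^ p)
        \<le> indicator I t *\<^sub>R (2 ^ p * (\<bar>m t\<bar> ^ p + \<bar>m t\<bar> ^ p))" for n
      using m(2)
    proof eventually_elim
      case (elim t)
      show ?case
      proof (cases "t \<in> I")
        case True
        have "norm (f (t, \<gamma> n t)) ^ p \<le> \<bar>m t\<bar> ^ p" "norm (f (t, \<sigma> n t)) ^ p \<le> \<bar>m t\<bar> ^ p"
          using elim inball[OF True] by (auto intro!: power_mono intro: order_trans[OF _ abs_ge_self])
        then have "2 ^ p * (norm (f (t, \<gamma> n t)) ^ p + norm (f (t, \<sigma> n t)) ^ p)
            \<le> 2 ^ p * (\<bar>m t\<bar> ^ p + \<bar>m t\<bar> ^ p)"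
          by (intro mult_left_mono add_mono) auto
        then have "norm (f (t, \<gamma> n t) + - f (t, \<sigma> n t)) ^ p \<le> 2 ^ p * (\<bar>m t\<bar> ^ p + \<bar>m t\<bar> ^ p)"
          using norm_add_power_le[of "f (t, \<gamma> n t)" "- f (t, \<sigma> n t)" p]
          unfolding norm_minus_cancel by (rule order_trans[rotated])
        then show ?thesis
          using True by simp
      qed simp
    qed
    show "AE t in lebesgue. (\<lambda>n. indicator I t *\<^sub>R norm (f (t, \<gamma> n t) - f (t, \<sigma> n t)) ^ p) \<longlonglongrightarrow> 0"
      using cont
    proof eventually_elim
      case (elim t)
      show ?case
      proof (cases "t \<in> I")
        case True
        have "uniformly_continuous_on (cball 0 (real j)) (\<lambda>x. f (t, x))"
          using elim by (intro compact_uniformly_continuous) (auto intro: continuous_on_subset)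
        moreover have "(\<lambda>n. dist (\<gamma> n t) (\<sigma> n t)) \<longlonglongrightarrow> 0"
          unfolding dist_norm
          by (rule Lim_null_comparison[OF _ LIMSEQ_inverse_real_of_nat]) (use c(3)[OF True] in auto)
        ultimately have "(\<lambda>n. dist (f (t, \<gamma> n t)) (f (t, \<sigma> n t))) \<longlonglongrightarrow> 0"
          using inball[OF True] unfolding uniformly_continuous_on_sequentially by auto
        then have "(\<lambda>n. norm (f (t, \<gamma> n t) - f (t, \<sigma> n t)) ^ p) \<longlonglongrightarrow> 0"
          unfolding dist_norm using p by (intro tendsto_null_power) auto
        then show ?thesis using True by (simp only: indicator_simps scaleR_one)
      qed simp
    qed
  qed simp
  then have "(\<lambda>n. LINT t:I|lebesgue. norm (f (t, \<gamma> n t) - f (t, \<sigma> n t)) ^ p) \<longlonglongrightarrow> 0"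
    by (simp add: set_lebesgue_integral_def)
  then have "\<forall>\<^sub>F n in sequentially. (LINT t:I|lebesgue. norm (f (t, \<gamma> n t) - f (t, \<sigma> n t)) ^ p) < \<epsilon>"
    using e by (rule order_tendstoD)
  then show False
    using c(4) by (auto simp: eventually_sequentially dest: less_asym)
qed

text \<open>
  The optimal l-bound is not known to be measurable, so it is only compared with the integrand
  under the upper integral and never becomes part of a Bochner integral.
\<close>

lemma LINT_norm_diff_power_le_lbound:
  fixes f :: "real \<times> (real^'m) \<Rightarrow> real^'n"
  assumes f: "f \<in> SC_fun p" and p: "p \<ge> 1" and I: "I \<in> rat_intervals"
    and g: "\<gamma> \<in> meas_curves I j" and s: "\<sigma> \<in> meas_curves I j"
    and near: "\<And>t. t \<in> I \<Longrightarrow> norm (\<gamma> t - \<sigma> t) \<le> \<eta>" and "\<eta> > 0"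
    and C: "set_nn_integral lebesgue I (\<lambda>t. opt_lbound f j t ^ p) \<le> ennreal C" and "C \<ge> 0"
  shows "(LINT t:I|lebesgue. norm (f (t, \<gamma> t) - f (t, \<sigma> t)) ^ p) \<le> \<eta> ^ p * C"
proof -
  define h where "h t = norm (f (t, \<gamma> t) - f (t, \<sigma> t))" for t
  have int: "set_integrable lebesgue I (\<lambda>t. (h t / \<eta>) ^ p)"
    using set_integrable_norm_diff_power[OF f p I g s] by (simp add: h_def power_divide)
  have le: "ennreal ((h t / \<eta>) ^ p) \<le> opt_lbound f j t ^ p" if "t \<in> I" for t
  proof (cases "\<gamma> t = \<sigma> t")
    case True
    then show ?thesis using p by (simp add: h_def power_0_left)
  next
    case False
    have "\<gamma> t \<in> cball 0 (real j)" "\<sigma> t \<in> cball 0 (real j)"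
      using g s that by (auto simp: meas_curves_def simp del: mem_cball)
    then have 1: "ennreal (h t / norm (\<gamma> t - \<sigma> t)) \<le> opt_lbound f j t"
      unfolding opt_lbound_def h_def using False
      by (intro SUP_upper2[of "(\<gamma> t, \<sigma> t)"]) auto
    have "h t / \<eta> \<le> h t / norm (\<gamma> t - \<sigma> t)"
      using False near[OF that] \<open>\<eta> > 0\<close> by (intro divide_left_mono) (auto simp: h_def intro!: mult_pos_pos)
    then have "ennreal (h t / \<eta>) \<le> opt_lbound f j t"
      using 1 ennreal_leI order_trans by blast
    then have "ennreal (h t / \<eta>) ^ p \<le> opt_lbound f j t ^ p"
      by (intro power_mono) auto
    then show ?thesis
      using \<open>\<eta> > 0\<close> by (simp add: ennreal_power h_def)
  qed
  have "ennreal (LINT t:I|lebesgue. (h t / \<eta>) ^ p) = (\<integral>\<^sup>+t. ennreal (indicator I t *\<^sub>R (h t / \<eta>) ^ p) \<partial>lebesgue)"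
    unfolding set_lebesgue_integral_def using int \<open>\<eta> > 0\<close>
    by (intro nn_integral_eq_integral[symmetric]) (auto simp: h_def set_integrable_def)
  also have "\<dots> \<le> set_nn_integral lebesgue I (\<lambda>t. opt_lbound f j t ^ p)"
    by (intro nn_integral_mono) (auto simp: indicator_def le)
  also note C
  finally have "(LINT t:I|lebesgue. (h t / \<eta>) ^ p) \<le> C"
    using \<open>C \<ge> 0\<close> by simp
  then show ?thesis
    using \<open>\<eta> > 0\<close> by (simp add: h_def power_divide field_simps)
qed

text \<open>\<open>\<eta>\<close> is chosen before \<open>g\<close>, which enters only through the
  bound \<open>C\<close>: the integrated increment of \<open>g\<close> is at most
  \<open>\<eta> ^ p * C\<close>, while that of \<open>f\<close> is made small by
  \<open>SC_fun_modulus\<close>.\<close>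

lemma difference_modulus:
  fixes f :: "real \<times> (real^'m) \<Rightarrow> real^'n"
  assumes f: "f \<in> SC_fun p" and p: "p \<ge> 1" and I: "I \<in> rat_intervals" and e: "\<epsilon> > 0"
    and C: "C \<ge> 0"
  obtains \<eta> where "\<eta> > 0"
    "\<forall>g\<in>SC_fun p. set_nn_integral lebesgue I (\<lambda>t. opt_lbound g j t ^ p) \<le> ennreal C \<longrightarrow>
      (\<forall>\<gamma>\<in>meas_curves I j. \<forall>\<sigma>\<in>meas_curves I j. (\<forall>t\<in>I. norm (\<gamma> t - \<sigma> t) \<le> \<eta>) \<longrightarrow>
      (LINT t:I|lebesgue. norm ((g (t, \<gamma> t) - f (t, \<gamma> t)) - (g (t, \<sigma> t) - f (t, \<sigma> t))) ^ p) \<le> \<epsilon>)"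
proof -
  \<comment> \<open>Chosen so that \<open>2 ^ p * (r + r)\<close> equals
    \<open>\<epsilon>\<close>.\<close>
  define r where "r = \<epsilon> / (2 * 2 ^ p)"
  have "r > 0" using e by (simp add: r_def)
  obtain \<eta>1 where \<eta>1: "\<eta>1 > 0"
    "\<forall>\<gamma>\<in>meas_curves I j. \<forall>\<sigma>\<in>meas_curves I j. (\<forall>t\<in>I. norm (\<gamma> t - \<sigma> t) \<le> \<eta>1) \<longrightarrow>
      (LINT t:I|lebesgue. norm (f (t, \<gamma> t) - f (t, \<sigma> t)) ^ p) \<le> r"
    using SC_fun_modulus[OF f p I \<open>r > 0\<close>, where j = j] by (elim exE conjE)
  \<comment> \<open>The cap 1 gives \<open>\<eta> ^ p \<le> \<eta>\<close>, and dividing by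
    \<open>C + 1\<close> instead of \<open>C\<close> allows \<open>C = 0\<close>.\<close>
  define \<eta> where "\<eta> = min \<eta>1 (min 1 (r / (C + 1)))"
  have \<eta>: "\<eta> > 0" "\<eta> \<le> 1" "\<eta> \<le> \<eta>1" "\<eta> \<le> r / (C + 1)"
    using \<eta>1(1) \<open>r > 0\<close> C by (auto simp: \<eta>_def)
  have "\<eta> ^ p * C \<le> r"
  proof -
    have "\<eta> ^ p \<le> \<eta> ^ 1" using \<eta> p by (intro power_decreasing) auto
    then have "\<eta> ^ p * C \<le> r / (C + 1) * C" using \<eta>(4) C by (intro mult_right_mono) auto
    also have "\<dots> \<le> r" using C \<open>r > 0\<close> by (simp add: field_simps)
    finally show ?thesis .
  qed
  show ?thesis
  proof (rule that[OF \<eta>(1)], intro ballI impI)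
    fix g :: "real \<times> (real^'m) \<Rightarrow> real^'n" and \<gamma> \<sigma> :: "real \<Rightarrow> real^'m"
    assume g: "g \<in> SC_fun p" and l: "set_nn_integral lebesgue I (\<lambda>t. opt_lbound g j t ^ p) \<le> ennreal C"
      and gs: "\<gamma> \<in> meas_curves I j" "\<sigma> \<in> meas_curves I j" and near: "\<forall>t\<in>I. norm (\<gamma> t - \<sigma> t) \<le> \<eta>"
    note int_f = set_integrable_norm_diff_power[OF f p I gs]
    note int_g = set_integrable_norm_diff_power[OF g p I gs]
    have "(LINT t:I|lebesgue. norm ((g (t, \<gamma> t) - f (t, \<gamma> t)) - (g (t, \<sigma> t) - f (t, \<sigma> t))) ^ p)
        \<le> (LINT t:I|lebesgue. 2 ^ p * (norm (g (t, \<gamma> t) - g (t, \<sigma> t)) ^ p + norm (f (t, \<gamma> t) - f (t, \<sigma> t)) ^ p))"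
    proof (rule set_integral_mono)
      show "set_integrable lebesgue I (\<lambda>t. norm ((g (t, \<gamma> t) - f (t, \<gamma> t)) - (g (t, \<sigma> t) - f (t, \<sigma> t))) ^ p)"
        by (rule set_integrable_norm_diff_power[OF SC_fun_diff[OF g f] p I gs])
      show "set_integrable lebesgue I (\<lambda>t. 2 ^ p * (norm (g (t, \<gamma> t) - g (t, \<sigma> t)) ^ p + norm (f (t, \<gamma> t) - f (t, \<sigma> t)) ^ p))"
        by (intro set_integrable_mult_right set_integral_add int_f int_g)
      show "norm ((g (t, \<gamma> t) - f (t, \<gamma> t)) - (g (t, \<sigma> t) - f (t, \<sigma> t))) ^ p
          \<le> 2 ^ p * (norm (g (t, \<gamma> t) - g (t, \<sigma> t)) ^ p + norm (f (t, \<gamma> t) - f (t, \<sigma> t)) ^ p)" for t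
      proof -
        have "(g (t, \<gamma> t) - f (t, \<gamma> t)) - (g (t, \<sigma> t) - f (t, \<sigma> t))
            = (g (t, \<gamma> t) - g (t, \<sigma> t)) + - (f (t, \<gamma> t) - f (t, \<sigma> t))" by simp
        then show ?thesis
          using norm_add_power_le[of "g (t, \<gamma> t) - g (t, \<sigma> t)" "- (f (t, \<gamma> t) - f (t, \<sigma> t))" p]
          unfolding norm_minus_cancel by (simp only:)
      qed
    qed
    also have "\<dots> = 2 ^ p * ((LINT t:I|lebesgue. norm (g (t, \<gamma> t) - g (t, \<sigma> t)) ^ p)
        + (LINT t:I|lebesgue. norm (f (t, \<gamma> t) - f (t, \<sigma> t)) ^ p))"
      by (simp only: set_integral_mult_right set_integral_add(2)[OF int_g int_f])
    also have "\<dots> \<le> 2 ^ p * (r + r)"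
    proof (intro mult_left_mono add_mono)
      show "(LINT t:I|lebesgue. norm (g (t, \<gamma> t) - g (t, \<sigma> t)) ^ p) \<le> r"
        using LINT_norm_diff_power_le_lbound[OF g p I gs bspec[OF near] \<eta>(1) l C] \<open>\<eta> ^ p * C \<le> r\<close> by (rule order_trans)
      have "\<forall>t\<in>I. norm (\<gamma> t - \<sigma> t) \<le> \<eta>1"
        using near \<eta>(3) by (meson order_trans)
      then show "(LINT t:I|lebesgue. norm (f (t, \<gamma> t) - f (t, \<sigma> t)) ^ p) \<le> r"
        using \<eta>1(2) gs by simp
    qed simp
    also have "\<dots> = \<epsilon>" by (simp add: r_def)
    finally show "(LINT t:I|lebesgue. norm ((g (t, \<gamma> t) - f (t, \<gamma> t)) - (g (t, \<sigma> t) - f (t, \<sigma> t))) ^ p) \<le> \<epsilon>" .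
  qed
qed

text \<open>The compact ball is covered by small balls around points of \<open>D\<close>, and
  centres that are too remote are discarded. The net is allowed in the ball of index
  \<open>Suc j\<close> since \<open>D\<close> may have no point in the smaller one: for
  \<open>j = 0\<close> that ball is a single point.\<close>

lemma finite_net_in_dense:
  fixes D :: "'a::euclidean_space set"
  assumes D: "closure D = UNIV" and "\<eta> > 0"
  obtains X where "finite X" "X \<subseteq> D" "X \<subseteq> cball 0 (real (Suc j))" "X \<noteq> {}"
    "\<forall>y\<in>cball 0 (real j). \<exists>x\<in>X. norm (y - x) \<le> \<eta>"
proof -
  \<comment> \<open>The cap 1 ensures that a centre within \<open>r\<close> of the ball of radius
    \<open>j\<close> has norm at most \<open>Suc j\<close>.\<close>
  define r where "r = min \<eta> 1"
  have "r > 0" using assms by (simp add: r_def)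
  have near: "\<exists>x\<in>D. y \<in> ball x r" for y
    using D \<open>r > 0\<close> closure_approachable[of y D] by (auto simp: dist_commute)
  have "cball 0 (real j) \<subseteq> (\<Union>x\<in>D. ball x r)"
    using near by blast
  then obtain Y where Y: "Y \<subseteq> D" "finite Y" "cball 0 (real j) \<subseteq> (\<Union>x\<in>Y. ball x r)"
    using compactE_image[OF compact_cball, of D "\<lambda>x. ball x r" 0 "real j"] by auto
  define X where "X = Y \<inter> cball 0 (real (Suc j))"
  have n: "\<exists>x\<in>X. norm (y - x) \<le> \<eta>" if y: "y \<in> cball 0 (real j)" for y
  proof -
    obtain x where x: "x \<in> Y" "y \<in> ball x r" using Y(3) y by blast
    then have "norm (y - x) < r" by (simp add: dist_norm norm_minus_commute)
    moreover have "norm x \<le> norm y + norm (y - x)"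
      using norm_triangle_ineq4[of y "y - x"] by simp
    ultimately show ?thesis
      using x(1) y by (intro bexI[of _ x]) (auto simp: X_def r_def)
  qed
  show ?thesis
  proof (rule that[of X])
    show "X \<noteq> {}" using n[of 0] by auto
  qed (use Y n in \<open>auto simp: X_def\<close>)
qed

text \<open>Numbering the net and taking the least index of a point within \<open>\<eta>\<close>
  turns the choice of a nearby point into a measurable function of \<open>t\<close>.\<close>

lemma meas_curves_selection:
  fixes \<gamma> :: "real \<Rightarrow> real^'m"
  assumes g: "\<gamma> \<in> meas_curves I j" and I: "I \<in> rat_intervals"
    and X: "finite X" "X \<subseteq> cball 0 (real k)"
    and net: "\<forall>y\<in>cball 0 (real j). \<exists>x\<in>X. norm (y - x) \<le> \<eta>"
  obtains \<sigma> where "\<sigma> \<in> meas_curves I k" "\<forall>t\<in>I. \<sigma> t \<in> X" "\<forall>t\<in>I. norm (\<gamma> t - \<sigma> t) \<le> \<eta>"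
proof -
  obtain xs :: "nat \<Rightarrow> real^'m" and n where xs: "X = xs ` {i. i < n}"
    using finite_imp_nat_seg_image_inj_on[OF X(1)] by blast
  define c where "c t = indicator I t *\<^sub>R \<gamma> t" for t
  have [measurable]: "c \<in> borel_measurable borel" "I \<in> sets borel"
    using g I by (auto simp: meas_curves_def c_def[abs_def] rat_intervals_def)
  have cI: "c t = \<gamma> t" "c t \<in> cball 0 (real j)" if "t \<in> I" for t
    using g that by (auto simp: c_def meas_curves_def simp del: mem_cball)
  define \<kappa> where "\<kappa> t = (LEAST i. i < n \<and> norm (c t - xs i) \<le> \<eta>)" for t
  have [measurable]: "\<kappa> \<in> measurable borel (count_space UNIV)"
    unfolding \<kappa>_def[abs_def] by measurable
  have \<kappa>: "\<kappa> t < n \<and> norm (c t - xs (\<kappa> t)) \<le> \<eta>" if t: "t \<in> I" for t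
  proof -
    obtain i where "i < n \<and> norm (c t - xs i) \<le> \<eta>"
      using bspec[OF net cI(2)[OF t]] xs by auto
    then show ?thesis unfolding \<kappa>_def by (rule LeastI)
  qed
  have [measurable]: "(\<lambda>t. xs (\<kappa> t)) \<in> borel_measurable borel"
    by measurable
  show ?thesis
  proof (rule that[of "\<lambda>t. xs (\<kappa> t)"])
    show *: "\<forall>t\<in>I. xs (\<kappa> t) \<in> X"
      using \<kappa> xs by auto
    show "\<forall>t\<in>I. norm (\<gamma> t - xs (\<kappa> t)) \<le> \<eta>"
      using \<kappa> cI(1) by simp
    have "(\<lambda>t. indicator I t *\<^sub>R xs (\<kappa> t)) \<in> borel_measurable borel" by measurable
    then show "(\<lambda>t. xs (\<kappa> t)) \<in> meas_curves I k"
      using * X(2) by (auto simp: meas_curves_def simp del: mem_cball)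
  qed
qed

section \<open>Strong estimate by finitely many pointwise integrals\<close>

lemma const_in_meas_curves: "x \<in> cball 0 (real j) \<Longrightarrow> I \<in> rat_intervals \<Longrightarrow> (\<lambda>t. x) \<in> meas_curves I j"
  by (intro subsetD[OF C_ball_subset_meas_curves]) (auto simp: C_ball_def)

lemma Lq_loc_bounded_lboundsE:
  assumes "Lq_loc_bounded_lbounds q E" "I \<in> rat_intervals"
  obtains C where "C \<ge> 0"
    "\<forall>G\<in>E. set_nn_integral lebesgue I (\<lambda>t. opt_lbound (repr G) j t ^ q) \<le> ennreal C"
proof -
  obtain a b where I: "I = {a..b}" using assms(2) by (auto simp: rat_intervals_def)
  \<comment> \<open>The summand 1 keeps \<open>r\<close> positive when \<open>I\<close> is
    \<open>{0}\<close>.\<close>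
  define r where "r = \<bar>a\<bar> + \<bar>b\<bar> + 1"
  have r: "r > 0" "I \<subseteq> {-r..r}" by (auto simp: r_def I)
  let ?S = "SUP F\<in>E. set_nn_integral lebesgue {-r..r} (\<lambda>t. opt_lbound (repr F) j t ^ q)"
  have "?S < \<infinity>" using assms(1) r(1) by (simp add: Lq_loc_bounded_lbounds_def)
  then have S: "?S = ennreal (enn2real ?S)" by simp
  show ?thesis
  proof (rule that[of "enn2real ?S"], simp, rule ballI)
    fix G assume "G \<in> E"
    have "set_nn_integral lebesgue I (\<lambda>t. opt_lbound (repr G) j t ^ q)
        \<le> set_nn_integral lebesgue {-r..r} (\<lambda>t. opt_lbound (repr G) j t ^ q)"
      by (rule nn_set_integral_set_mono[OF r(2)])
    also have "\<dots> \<le> ?S" using \<open>G \<in> E\<close> by (rule SUP_upper)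
    finally show "set_nn_integral lebesgue I (\<lambda>t. opt_lbound (repr G) j t ^ q) \<le> ennreal (enn2real ?S)"
      using S by simp
  qed
qed

text \<open>The selection \<open>\<sigma>\<close> depends on \<open>\<gamma>\<close> and
  \<open>t\<close> in an uncontrolled way, but its values lie in \<open>X\<close>, so
  \<open>norm (h (t, \<sigma> t)) ^ p\<close> is bounded by the sum over all \<open>x\<close> in
  \<open>X\<close>. What remains are finitely many pointwise integrals over the whole of
  \<open>I\<close>, independent of \<open>\<gamma>\<close>.\<close>

lemma strong_approximation:
  fixes E :: "(real \<times> (real^'m) \<Rightarrow> real^'n) set set"
  assumes p: "p \<ge> 1" and E: "E \<subseteq> SC p" and l: "Lq_loc_bounded_lbounds p E" and F: "F \<in> SC p"
    and I: "I \<in> rat_intervals" and D: "closure D = UNIV" and e: "\<epsilon> > 0"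
  obtains X \<delta> where "finite X" "X \<subseteq> D" "\<delta> > 0"
    "\<forall>G\<in>E. (\<forall>x\<in>X. (LINT t:I|lebesgue. norm (repr G (t, x) - repr F (t, x)) ^ p) \<le> \<delta>) \<longrightarrow>
      (\<forall>\<gamma>\<in>meas_curves I j. (LINT t:I|lebesgue. norm (repr G (t, \<gamma> t) - repr F (t, \<gamma> t)) ^ p) \<le> \<epsilon>)"
proof -
  note f = repr_in_SC_fun[OF p F]
  obtain C where C: "C \<ge> 0"
    "\<forall>G\<in>E. set_nn_integral lebesgue I (\<lambda>t. opt_lbound (repr G) (Suc j) t ^ p) \<le> ennreal C"
    by (rule Lq_loc_bounded_lboundsE[OF l I, where j = "Suc j"]) (rule that)
  define r where "r = \<epsilon> / (2 * 2 ^ p)"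
  have r: "r > 0" using e by (simp add: r_def)
  obtain \<eta> where \<eta>: "\<eta> > 0"
    "\<forall>g\<in>SC_fun p. set_nn_integral lebesgue I (\<lambda>t. opt_lbound g (Suc j) t ^ p) \<le> ennreal C \<longrightarrow>
      (\<forall>\<gamma>\<in>meas_curves I (Suc j). \<forall>\<sigma>\<in>meas_curves I (Suc j). (\<forall>t\<in>I. norm (\<gamma> t - \<sigma> t) \<le> \<eta>) \<longrightarrow>
      (LINT t:I|lebesgue. norm ((g (t, \<gamma> t) - repr F (t, \<gamma> t)) - (g (t, \<sigma> t) - repr F (t, \<sigma> t))) ^ p) \<le> r)"
    by (rule difference_modulus[OF f p I r C(1), where j = "Suc j"]) (rule that)
  obtain X where X: "finite X" "X \<subseteq> D" "X \<subseteq> cball 0 (real (Suc j))" "X \<noteq> {}"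
    "\<forall>y\<in>cball 0 (real j). \<exists>x\<in>X. norm (y - x) \<le> \<eta>"
    by (rule finite_net_in_dense[OF D \<eta>(1), where j = j]) (rule that)
  \<comment> \<open>The \<open>card X\<close> pointwise integrals contribute at most
    \<open>r\<close> together and the increment along the curves another \<open>r\<close>; the total
    is \<open>2 ^ p * (r + r) = \<epsilon>\<close>.\<close>
  define \<delta> where "\<delta> = r / card X"
  have "card X > 0" using X by (simp add: card_gt_0_iff)
  show ?thesis
  proof (rule that[OF X(1,2), of \<delta>], use r \<open>card X > 0\<close> in \<open>simp add: \<delta>_def\<close>, intro ballI impI)
    fix G and \<gamma> :: "real \<Rightarrow> real^'m"
    assume G: "G \<in> E" and small: "\<forall>x\<in>X. (LINT t:I|lebesgue. norm (repr G (t, x) - repr F (t, x)) ^ p) \<le> \<delta>"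
      and \<gamma>: "\<gamma> \<in> meas_curves I j"
    have g: "repr G \<in> SC_fun p" using repr_in_SC_fun[OF p] E G by blast
    define h where "h z = repr G z - repr F z" for z
    have h: "h \<in> SC_fun p" unfolding h_def[abs_def] by (rule SC_fun_diff[OF g f])
    obtain \<sigma> where \<sigma>: "\<sigma> \<in> meas_curves I (Suc j)" "\<forall>t\<in>I. \<sigma> t \<in> X" "\<forall>t\<in>I. norm (\<gamma> t - \<sigma> t) \<le> \<eta>"
      by (rule meas_curves_selection[OF \<gamma> I X(1,3,5)]) (rule that)
    have \<gamma>': "\<gamma> \<in> meas_curves I (Suc j)" using \<gamma> meas_curves_mono[of j "Suc j" I] by auto
    have ix: "set_integrable lebesgue I (\<lambda>t. norm (h (t, x)) ^ p)" if "x \<in> X" for x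
      using set_integrable_norm_power[OF h p I const_in_meas_curves[OF _ I]] X(3) that by blast
    have isum: "set_integrable lebesgue I (\<lambda>t. \<Sum>x\<in>X. norm (h (t, x)) ^ p)"
      using ix by (simp add: set_integrable_def scaleR_sum_right del: real_scaleR_def)
    have id: "set_integrable lebesgue I (\<lambda>t. norm (h (t, \<gamma> t) - h (t, \<sigma> t)) ^ p)"
      by (rule set_integrable_norm_diff_power[OF h p I \<gamma>' \<sigma>(1)])
    have "(LINT t:I|lebesgue. norm (h (t, \<gamma> t)) ^ p)
        \<le> (LINT t:I|lebesgue. 2 ^ p * (norm (h (t, \<gamma> t) - h (t, \<sigma> t)) ^ p + (\<Sum>x\<in>X. norm (h (t, x)) ^ p)))"
    proof (rule set_integral_mono)
      show "set_integrable lebesgue I (\<lambda>t. norm (h (t, \<gamma> t)) ^ p)"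
        by (rule set_integrable_norm_power[OF h p I \<gamma>])
      show "set_integrable lebesgue I (\<lambda>t. 2 ^ p * (norm (h (t, \<gamma> t) - h (t, \<sigma> t)) ^ p + (\<Sum>x\<in>X. norm (h (t, x)) ^ p)))"
        by (intro set_integrable_mult_right set_integral_add id isum)
      fix t assume t: "t \<in> I"
      have "norm (h (t, \<gamma> t)) ^ p \<le> 2 ^ p * (norm (h (t, \<gamma> t) - h (t, \<sigma> t)) ^ p + norm (h (t, \<sigma> t)) ^ p)"
        using norm_add_power_le[of "h (t, \<gamma> t) - h (t, \<sigma> t)" "h (t, \<sigma> t)" p] by simp
      also have "\<dots> \<le> 2 ^ p * (norm (h (t, \<gamma> t) - h (t, \<sigma> t)) ^ p + (\<Sum>x\<in>X. norm (h (t, x)) ^ p))"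
        using member_le_sum[of "\<sigma> t" X "\<lambda>x. norm (h (t, x)) ^ p"] X(1) \<sigma>(2) t
        by (intro mult_left_mono add_left_mono) auto
      finally show "norm (h (t, \<gamma> t)) ^ p \<le> 2 ^ p * (norm (h (t, \<gamma> t) - h (t, \<sigma> t)) ^ p + (\<Sum>x\<in>X. norm (h (t, x)) ^ p))" .
    qed
    also have "\<dots> = 2 ^ p * ((LINT t:I|lebesgue. norm (h (t, \<gamma> t) - h (t, \<sigma> t)) ^ p)
        + (LINT t:I|lebesgue. \<Sum>x\<in>X. norm (h (t, x)) ^ p))"
      by (simp only: set_integral_mult_right set_integral_add(2)[OF id isum])
    also have "(LINT t:I|lebesgue. \<Sum>x\<in>X. norm (h (t, x)) ^ p) = (\<Sum>x\<in>X. LINT t:I|lebesgue. norm (h (t, x)) ^ p)"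
      using ix unfolding set_lebesgue_integral_def set_integrable_def scaleR_sum_right
      by (intro Bochner_Integration.integral_sum)
    also have "2 ^ p * ((LINT t:I|lebesgue. norm (h (t, \<gamma> t) - h (t, \<sigma> t)) ^ p) + (\<Sum>x\<in>X. LINT t:I|lebesgue. norm (h (t, x)) ^ p))
       \<le> 2 ^ p * (r + (\<Sum>x\<in>X. \<delta>))"
      using small bspec[OF bspec[OF mp[OF bspec[OF \<eta>(2) g] bspec[OF C(2) G]] \<gamma>'] \<sigma>(1)] \<sigma>(3)
      by (intro mult_left_mono add_mono sum_mono) (simp_all add: h_def)
    also have "\<dots> = \<epsilon>"
      using \<open>card X > 0\<close> by (simp add: \<delta>_def r_def)
    finally show "(LINT t:I|lebesgue. norm (repr G (t, \<gamma> t) - repr F (t, \<gamma> t)) ^ p) \<le> \<epsilon>"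
      by (simp add: h_def)
  qed
qed

section \<open>Step curves over a partition and the weak estimate\<close>

lemma set_integrable_along:
  fixes f :: "real \<times> (real^'m) \<Rightarrow> real^'n"
  assumes f: "f \<in> SC_fun 1" and I: "I \<in> rat_intervals" and g: "\<gamma> \<in> meas_curves I j"
  shows "set_integrable lebesgue I (\<lambda>t. f (t, \<gamma> t))"
proof (rule set_integrable_bound)
  show "set_integrable lebesgue I (\<lambda>t. norm (f (t, \<gamma> t)) ^ 1)"
    by (rule set_integrable_norm_power[OF f _ I g]) simp
  show "set_borel_measurable lebesgue I (\<lambda>t. f (t, \<gamma> t))"
    using f by (intro set_borel_measurable_along[OF _ g I]) (simp add: SC_fun_def)
qed simp

lemma norm_set_integral_le:
  fixes \<phi> :: "'b \<Rightarrow> 'a::{banach, second_countable_topology}"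
  shows "norm (LINT t:I|M. \<phi> t) \<le> (LINT t:I|M. norm (\<phi> t))"
proof -
  have "norm (LINT t:I|M. \<phi> t) \<le> (LINT t|M. norm (indicator I t *\<^sub>R \<phi> t))"
    unfolding set_lebesgue_integral_def by (rule integral_norm_bound)
  also have "\<dots> = (LINT t:I|M. norm (\<phi> t))"
    unfolding set_lebesgue_integral_def by (intro Bochner_Integration.integral_cong) (auto simp: indicator_def)
  finally show ?thesis .
qed

text \<open>The pieces are closed because \<open>rat_intervals\<close> contains only closed
  intervals; neighbours overlap in an endpoint, which is a null set. \<open>mono s\<close> admits
  degenerate pieces, as occur when \<open>I\<close> is a single point.\<close>

lemma norm_set_integral_partition_le:
  fixes \<phi> :: "real \<Rightarrow> 'a::{banach, second_countable_topology}"
  assumes "mono s" "set_integrable lebesgue {s 0..s n} \<phi>"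
  shows "norm (LINT t:{s 0..s n}|lebesgue. \<phi> t) \<le> (\<Sum>k<n. norm (LINT t:{s k..s (Suc k)}|lebesgue. \<phi> t))"
  using assms(2)
proof (induction n)
  case 0
  have "AE t in lebesgue. t \<noteq> s 0"
    by (rule AE_completion[OF AE_lborel_singleton])
  then have "AE t in lebesgue. indicator {s 0..s 0} t *\<^sub>R \<phi> t = 0"
    by eventually_elim (auto simp: indicator_def)
  then have "(LINT t:{s 0..s 0}|lebesgue. \<phi> t) = 0"
    unfolding set_lebesgue_integral_def by (rule integral_eq_zero_AE)
  then show ?case by simp
next
  case (Suc n)
  have le: "s 0 \<le> s n" "s n \<le> s (Suc n)" using assms(1) by (auto intro: monoD)
  then have un: "{s 0..s (Suc n)} = {s 0..s n} \<union> {s n..s (Suc n)}" by auto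
  have int: "set_integrable lebesgue {s 0..s n} \<phi>" "set_integrable lebesgue {s n..s (Suc n)} \<phi>"
    using le by (auto intro!: set_integrable_subset[OF Suc.prems])
  have "AE t in lebesgue. t \<noteq> s n"
    by (rule AE_completion[OF AE_lborel_singleton])
  then have "AE t in lebesgue. \<not> (t \<in> {s 0..s n} \<and> t \<in> {s n..s (Suc n)})"
    by eventually_elim auto
  then have "(LINT t:{s 0..s (Suc n)}|lebesgue. \<phi> t)
      = (LINT t:{s 0..s n}|lebesgue. \<phi> t) + (LINT t:{s n..s (Suc n)}|lebesgue. \<phi> t)"
    unfolding un by (rule set_integral_Un_AE) (use int in auto)
  then show ?case
    using norm_triangle_ineq[of "LINT t:{s 0..s n}|lebesgue. \<phi> t" "LINT t:{s n..s (Suc n)}|lebesgue. \<phi> t"]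
      Suc.IH[OF int(1)] by simp
qed

text \<open>At a common endpoint two pieces compete for the value. The second property holds at
  every point of \<open>I\<close> and gives closeness to a given curve; the third fixes the value on
  a piece up to its left endpoint, which is enough under an integral.\<close>

lemma step_curve:
  fixes x :: "nat \<Rightarrow> real^'m"
  assumes s: "mono s" and I: "I = {s 0..s n}" and "n \<ge> 1"
    and x: "\<forall>k<n. x k \<in> cball 0 (real j)"
  obtains \<sigma> where "\<sigma> \<in> meas_curves I j"
    "\<forall>t\<in>I. \<exists>k<n. t \<in> {s k..s (Suc k)} \<and> \<sigma> t = x k"
    "\<forall>k<n. \<forall>t\<in>{s k<..s (Suc k)}. \<sigma> t = x k"
proof -
  \<comment> \<open>The least index assigns an interior partition point to a piece on its left and
    \<open>s 0\<close> to the first piece, and it is measurable in \<open>t\<close>.\<close>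
  define \<kappa> where "\<kappa> t = (LEAST k. t \<le> s (Suc k))" for t
  have [measurable]: "\<kappa> \<in> measurable borel (count_space UNIV)" "I \<in> sets borel"
    unfolding \<kappa>_def[abs_def] I by measurable
  have \<kappa>: "\<kappa> t < n \<and> t \<in> {s (\<kappa> t)..s (Suc (\<kappa> t))}" if "t \<in> I" for t
  proof -
    have 1: "t \<le> s (Suc (n - 1))" using that \<open>n \<ge> 1\<close> by (simp add: I)
    then have 2: "t \<le> s (Suc (\<kappa> t))" unfolding \<kappa>_def by (rule LeastI)
    have 3: "\<kappa> t \<le> n - 1" using 1 unfolding \<kappa>_def by (rule Least_le)
    have "s (\<kappa> t) \<le> t"
    proof (cases "\<kappa> t")
      case 0
      then show ?thesis using that by (simp add: I)
    next
      case (Suc i)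
      then have "\<not> t \<le> s (Suc i)"
        using not_less_Least[of i "\<lambda>k. t \<le> s (Suc k)"] by (simp add: \<kappa>_def)
      then show ?thesis using Suc by simp
    qed
    with 2 3 \<open>n \<ge> 1\<close> show ?thesis by auto
  qed
  show ?thesis
  proof (rule that[of "\<lambda>t. x (\<kappa> t)"])
    have "(\<lambda>t. indicator I t *\<^sub>R x (\<kappa> t)) \<in> borel_measurable borel" by measurable
    then show "(\<lambda>t. x (\<kappa> t)) \<in> meas_curves I j"
      using \<kappa> x by (auto simp: meas_curves_def simp del: mem_cball)
    show "\<forall>t\<in>I. \<exists>k<n. t \<in> {s k..s (Suc k)} \<and> x (\<kappa> t) = x k"
      using \<kappa> by blast
    have "\<kappa> t = k" if "t \<in> {s k<..s (Suc k)}" for t k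
      unfolding \<kappa>_def
    proof (rule Least_equality)
      show "k \<le> i" if t: "t \<le> s (Suc i)" for i
      proof (rule ccontr)
        assume "\<not> k \<le> i"
        then have "s (Suc i) \<le> s k" by (intro monoD[OF s]) simp
        moreover have "s k < t" using \<open>t \<in> {s k<..s (Suc k)}\<close> by simp
        ultimately show False using \<open>t \<le> s (Suc i)\<close> by linarith
      qed
    qed (use that in auto)
    then show "\<forall>k<n. \<forall>t\<in>{s k<..s (Suc k)}. x (\<kappa> t) = x k" by auto
  qed
qed

lemma set_integral_step_piece:
  fixes f :: "real \<times> (real^'m) \<Rightarrow> real^'n"
  assumes "set_integrable lebesgue {a..b} (\<lambda>t. f (t, \<sigma> t))" "set_integrable lebesgue {a..b} (\<lambda>t. f (t, x))"
    and "\<forall>t\<in>{a<..b}. \<sigma> t = x"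
  shows "(LINT t:{a..b}|lebesgue. f (t, \<sigma> t)) = (LINT t:{a..b}|lebesgue. f (t, x))"
  unfolding set_lebesgue_integral_def
proof (rule integral_cong_AE)
  have "AE t in lebesgue. t \<noteq> a"
    by (rule AE_completion[OF AE_lborel_singleton])
  then show "AE t in lebesgue. indicator {a..b} t *\<^sub>R f (t, \<sigma> t) = indicator {a..b} t *\<^sub>R f (t, x)"
    by eventually_elim (use assms(3) in \<open>auto simp: indicator_def\<close>)
qed (use assms(1,2) in \<open>auto simp: set_integrable_def intro: borel_measurable_integrable\<close>)

text \<open>With the norm outside the integral, summing over all net points is useless: a small
  integral over \<open>I\<close> says nothing about subsets of \<open>I\<close>. Equicontinuity
  yields one partition of \<open>I\<close> for all \<open>\<gamma>\<close>, and
  \<open>\<gamma>\<close> is replaced by a step curve on it. The finitely many pairs of a piece and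
  a net point are then fixed before \<open>\<gamma>\<close> and \<open>G\<close>.\<close>

lemma weak_approximation:
  fixes E :: "(real \<times> (real^'m) \<Rightarrow> real^'n) set set"
  assumes E: "E \<subseteq> SC 1" and l: "Lq_loc_bounded_lbounds 1 E" and F: "F \<in> SC 1"
    and I: "I \<in> rat_intervals" and D: "closure D = UNIV" and e: "\<epsilon> > 0"
    and \<Gamma>: "\<Gamma> \<subseteq> C_ball I j"
    and equi: "\<And>\<epsilon>. \<epsilon> > 0 \<Longrightarrow> \<exists>\<delta>>0. \<forall>\<gamma>\<in>\<Gamma>. \<forall>s\<in>I. \<forall>t\<in>I. \<bar>t - s\<bar> < \<delta> \<longrightarrow> norm (\<gamma> t - \<gamma> s) \<le> \<epsilon>"
  obtains Q \<delta> where "finite Q" "Q \<subseteq> rat_intervals \<times> D" "\<delta> > 0"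
    "\<forall>G\<in>E. (\<forall>(J, x)\<in>Q. norm (LINT t:J|lebesgue. repr G (t, x) - repr F (t, x)) \<le> \<delta>) \<longrightarrow>
      (\<forall>\<gamma>\<in>\<Gamma>. norm (LINT t:I|lebesgue. repr G (t, \<gamma> t) - repr F (t, \<gamma> t)) \<le> \<epsilon>)"
proof -
  note f = repr_in_SC_fun[OF order_refl F]
  obtain C where C: "C \<ge> 0"
    "\<forall>G\<in>E. set_nn_integral lebesgue I (\<lambda>t. opt_lbound (repr G) (Suc j) t ^ 1) \<le> ennreal C"
    by (rule Lq_loc_bounded_lboundsE[OF l I, where j = "Suc j"]) (rule that)
  have e2: "\<epsilon> / 2 > 0" using e by simp
  obtain \<eta> where \<eta>: "\<eta> > 0"
    "\<forall>g\<in>SC_fun 1. set_nn_integral lebesgue I (\<lambda>t. opt_lbound g (Suc j) t ^ 1) \<le> ennreal C \<longrightarrow>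
      (\<forall>\<gamma>\<in>meas_curves I (Suc j). \<forall>\<sigma>\<in>meas_curves I (Suc j). (\<forall>t\<in>I. norm (\<gamma> t - \<sigma> t) \<le> \<eta>) \<longrightarrow>
      (LINT t:I|lebesgue. norm ((g (t, \<gamma> t) - repr F (t, \<gamma> t)) - (g (t, \<sigma> t) - repr F (t, \<sigma> t))) ^ 1) \<le> \<epsilon> / 2)"
    by (rule difference_modulus[OF f order_refl I e2 C(1), where j = "Suc j"]) (rule that)
  \<comment> \<open>Half of \<open>\<eta>\<close> is for the oscillation of \<open>\<gamma>\<close>
    on a piece, half for the distance of \<open>\<gamma> (s k)\<close> from the net.\<close>
  have \<eta>2: "\<eta> / 2 > 0" using \<eta>(1) by simp
  obtain X where X: "finite X" "X \<subseteq> D" "X \<subseteq> cball 0 (real (Suc j))" "X \<noteq> {}"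
    "\<forall>y\<in>cball 0 (real j). \<exists>x\<in>X. norm (y - x) \<le> \<eta> / 2"
    by (rule finite_net_in_dense[OF D \<eta>2, where j = j]) (rule that)
  obtain d where d: "d > 0" "\<forall>\<gamma>\<in>\<Gamma>. \<forall>s\<in>I. \<forall>t\<in>I. \<bar>t - s\<bar> < d \<longrightarrow> norm (\<gamma> t - \<gamma> s) \<le> \<eta> / 2"
    using equi[OF \<eta>2] by (elim exE conjE)
  obtain a b where ab: "I = {a..b}" "a \<in> \<rat>" "b \<in> \<rat>" "a \<le> b"
    using I by (auto simp: rat_intervals_def)
  obtain n0 where n0: "(b - a) / d < real n0" using reals_Archimedean2 by blast
  define n where "n = Suc n0"
  have n: "n \<ge> 1" "(b - a) / real n < d"
  proof -
    have "b - a < real n0 * d" using n0 d(1) by (simp add: field_simps)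
    also have "\<dots> < real n * d" using d(1) by (simp add: n_def)
    finally show "(b - a) / real n < d" by (simp add: n_def field_simps)
  qed (simp add: n_def)
  \<comment> \<open>Equidistant points between rational endpoints are rational, so the pieces belong
    to \<open>rat_intervals\<close>.\<close>
  define s where "s k = a + real k * ((b - a) / real n)" for k
  have "s (Suc k) - s k = (b - a) / real n" for k
    unfolding s_def of_nat_Suc distrib_right by simp
  moreover have "mono s"
    unfolding s_def using ab(4) by (intro monoI add_left_mono mult_right_mono) auto
  moreover have "I = {s 0..s n}"
    using n(1) by (simp add: s_def ab(1))
  moreover have "s k \<in> \<rat>" for k
    unfolding s_def using ab(2,3) by (intro Rats_add Rats_mult Rats_divide Rats_diff) auto
  ultimately have s: "mono s" "I = {s 0..s n}" "\<And>k. s k \<in> \<rat>" "\<And>k. s (Suc k) - s k < d"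
    using n(2) by simp_all
  have sI: "{s k..s (Suc k)} \<subseteq> I" "s k \<in> I" if "k < n" for k
    using monoD[OF s(1), of 0 k] monoD[OF s(1), of "Suc k" n] monoD[OF s(1), of k "Suc k"] that
    by (auto simp: s(2))
  have sr: "{s k..s (Suc k)} \<in> rat_intervals" for k
    using s(3) monoD[OF s(1), of k "Suc k"] by (auto simp: rat_intervals_def)
  define Q where "Q = (\<lambda>k. {s k..s (Suc k)}) ` {..<n} \<times> X"
  \<comment> \<open>The \<open>n\<close> pieces share \<open>\<epsilon> / 2\<close>; the other half
    is the error of replacing \<open>\<gamma>\<close> by the step curve.\<close>
  define \<delta> where "\<delta> = \<epsilon> / 2 / real n"
  show ?thesis
  proof (rule that[of Q \<delta>])
    show "finite Q" "Q \<subseteq> rat_intervals \<times> D" using X(1,2) sr by (auto simp: Q_def)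
    show "\<delta> > 0" using e n(1) by (simp add: \<delta>_def)
    show "\<forall>G\<in>E. (\<forall>(J, x)\<in>Q. norm (LINT t:J|lebesgue. repr G (t, x) - repr F (t, x)) \<le> \<delta>) \<longrightarrow>
      (\<forall>\<gamma>\<in>\<Gamma>. norm (LINT t:I|lebesgue. repr G (t, \<gamma> t) - repr F (t, \<gamma> t)) \<le> \<epsilon>)"
    proof (intro ballI impI)
      fix G \<gamma>
      assume G: "G \<in> E" and \<gamma>: "\<gamma> \<in> \<Gamma>"
        and small: "\<forall>(J, x)\<in>Q. norm (LINT t:J|lebesgue. repr G (t, x) - repr F (t, x)) \<le> \<delta>"
      have g: "repr G \<in> SC_fun 1" using repr_in_SC_fun[OF order_refl] E G by blast
      define h where "h z = repr G z - repr F z" for z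
      have h: "h \<in> SC_fun 1" unfolding h_def[abs_def] by (rule SC_fun_diff[OF g f])
      have \<gamma>C: "\<gamma> \<in> C_ball I j" using \<gamma> \<Gamma> by blast
      have \<gamma>': "\<gamma> \<in> meas_curves I (Suc j)"
        using \<gamma>C C_ball_subset_meas_curves[OF I, of j] meas_curves_mono[of j "Suc j" I] by auto
      have "\<exists>x\<in>X. norm (\<gamma> (s k) - x) \<le> \<eta> / 2" if "k < n" for k
        using X(5) \<gamma>C sI(2)[OF that] by (auto simp: C_ball_def)
      then obtain x where x: "\<And>k. k < n \<Longrightarrow> x k \<in> X" "\<And>k. k < n \<Longrightarrow> norm (\<gamma> (s k) - x k) \<le> \<eta> / 2"
        by metis
      have xb: "\<forall>k<n. x k \<in> cball 0 (real (Suc j))"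
        using x(1) X(3) by blast
      obtain \<sigma> where \<sigma>: "\<sigma> \<in> meas_curves I (Suc j)"
        "\<forall>t\<in>I. \<exists>k<n. t \<in> {s k..s (Suc k)} \<and> \<sigma> t = x k"
        "\<forall>k<n. \<forall>t\<in>{s k<..s (Suc k)}. \<sigma> t = x k"
        by (rule step_curve[OF s(1,2) n(1) xb]) (rule that)
      have near: "\<forall>t\<in>I. norm (\<gamma> t - \<sigma> t) \<le> \<eta>"
      proof
        fix t assume t: "t \<in> I"
        then obtain k where k: "k < n" "t \<in> {s k..s (Suc k)}" "\<sigma> t = x k" using \<sigma>(2) by blast
        have "\<bar>t - s k\<bar> < d" using k(2) s(4)[of k] by auto
        then have "norm (\<gamma> t - \<gamma> (s k)) \<le> \<eta> / 2"
          using d(2) \<gamma> t sI(2)[OF k(1)] by blast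
        with x(2)[OF k(1)] show "norm (\<gamma> t - \<sigma> t) \<le> \<eta>"
          using norm_triangle_ineq[of "\<gamma> t - \<gamma> (s k)" "\<gamma> (s k) - x k"] by (simp add: k(3))
      qed
      have ig: "set_integrable lebesgue I (\<lambda>t. h (t, \<gamma> t))"
        by (rule set_integrable_along[OF h I \<gamma>'])
      have i\<sigma>: "set_integrable lebesgue I (\<lambda>t. h (t, \<sigma> t))"
        by (rule set_integrable_along[OF h I \<sigma>(1)])
      \<comment> \<open>For the replacement error the norm may be moved inside, where the modulus
        obtained above for exponent 1 applies.\<close>
      have "norm ((LINT t:I|lebesgue. h (t, \<gamma> t)) - (LINT t:I|lebesgue. h (t, \<sigma> t))) \<le> \<epsilon> / 2"
      proof -
        have "norm ((LINT t:I|lebesgue. h (t, \<gamma> t)) - (LINT t:I|lebesgue. h (t, \<sigma> t)))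
            \<le> (LINT t:I|lebesgue. norm (h (t, \<gamma> t) - h (t, \<sigma> t)))"
          unfolding set_integral_diff(2)[OF ig i\<sigma>, symmetric] by (rule norm_set_integral_le)
        also have "\<dots> \<le> \<epsilon> / 2"
          using bspec[OF bspec[OF mp[OF bspec[OF \<eta>(2) g] bspec[OF C(2) G]] \<gamma>'] \<sigma>(1)] near
          by (simp add: h_def)
        finally show ?thesis .
      qed
      moreover have "norm (LINT t:I|lebesgue. h (t, \<sigma> t)) \<le> \<epsilon> / 2"
      proof -
        have "norm (LINT t:I|lebesgue. h (t, \<sigma> t)) \<le> (\<Sum>k<n. norm (LINT t:{s k..s (Suc k)}|lebesgue. h (t, \<sigma> t)))"
          using norm_set_integral_partition_le[OF s(1), of n "\<lambda>t. h (t, \<sigma> t)"] i\<sigma> by (simp add: s(2))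
        also have "\<dots> \<le> (\<Sum>k<n. \<delta>)"
        proof (rule sum_mono)
          fix k assume "k \<in> {..<n}"
          then have k: "k < n" by simp
          have "(LINT t:{s k..s (Suc k)}|lebesgue. h (t, \<sigma> t)) = (LINT t:{s k..s (Suc k)}|lebesgue. h (t, x k))"
          proof (rule set_integral_step_piece)
            show "set_integrable lebesgue {s k..s (Suc k)} (\<lambda>t. h (t, \<sigma> t))"
              by (rule set_integrable_subset[OF i\<sigma> _ sI(1)[OF k]]) simp
            show "set_integrable lebesgue {s k..s (Suc k)} (\<lambda>t. h (t, x k))"
              by (rule set_integrable_along[OF h sr const_in_meas_curves[OF xb[rule_format, OF k] sr]])
          qed (use \<sigma>(3) k in blast)
          moreover have "norm (LINT t:{s k..s (Suc k)}|lebesgue. h (t, x k)) \<le> \<delta>"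
            using small x(1)[OF k] k unfolding Q_def h_def by blast
          ultimately show "norm (LINT t:{s k..s (Suc k)}|lebesgue. h (t, \<sigma> t)) \<le> \<delta>" by simp
        qed
        also have "\<dots> = \<epsilon> / 2" using n(1) by (simp add: \<delta>_def)
        finally show ?thesis .
      qed
      ultimately have "norm (LINT t:I|lebesgue. h (t, \<gamma> t)) \<le> \<epsilon>"
        using norm_triangle_ineq[of "(LINT t:I|lebesgue. h (t, \<gamma> t)) - (LINT t:I|lebesgue. h (t, \<sigma> t))"
            "LINT t:I|lebesgue. h (t, \<sigma> t)"] by simp
      then show "norm (LINT t:I|lebesgue. repr G (t, \<gamma> t) - repr F (t, \<gamma> t)) \<le> \<epsilon>"
        by (simp add: h_def)
    qed
  qed
qed

section \<open>The seminorms\<close>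

text \<open>Convexity of the power function at the convex combination of \<open>a / A\<close> and \<open>b / B\<close>.\<close>

lemma power_add_weighted_le:
  fixes a b A B :: real
  assumes "a \<ge> 0" "b \<ge> 0" "A > 0" "B > 0"
  shows "(a + b) ^ p \<le> (A + B) ^ p * ((A / (A + B)) * (a / A) ^ p + (B / (A + B)) * (b / B) ^ p)"
proof -
  have conv: "convex_on {0::real..} (\<lambda>x. x ^ p)"
    using convex_power_odd[of p] convex_on_subset[OF convex_power_even[of p], of "{0..}"]
    by (cases "even p") (auto simp: convex_on_def)
  define t where "t = B / (A + B)"
  have t: "0 \<le> t" "t \<le> 1" "1 - t = A / (A + B)"
    using assms by (auto simp: t_def field_simps)
  have "((1 - t) *\<^sub>R (a / A) + t *\<^sub>R (b / B)) ^ p \<le> (1 - t) * (a / A) ^ p + t * (b / B) ^ p"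
    using assms t by (intro convex_onD[OF conv]) auto
  then have le: "(A + B) ^ p * ((1 - t) *\<^sub>R (a / A) + t *\<^sub>R (b / B)) ^ p
      \<le> (A + B) ^ p * ((1 - t) * (a / A) ^ p + t * (b / B) ^ p)"
    using assms by (intro mult_left_mono) auto
  have "a + b = (A + B) * ((1 - t) *\<^sub>R (a / A) + t *\<^sub>R (b / B))"
    unfolding t(3) unfolding t_def using assms by (simp add: distrib_left)
  then have "(a + b) ^ p = (A + B) ^ p * ((1 - t) *\<^sub>R (a / A) + t *\<^sub>R (b / B)) ^ p"
    by (simp only: power_mult_distrib)
  with le show ?thesis unfolding t(3) by (simp add: t_def)
qed

text \<open>Convexity with the weights \<open>A / (A + B)\<close> and \<open>B / (A + B)\<close>
  bounds the integrand by \<open>u * a t ^ p + v * b t ^ p\<close>, and \<open>u\<close>,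
  \<open>v\<close> are such that \<open>u * A ^ p + v * B ^ p = (A + B) ^ p\<close>. Working with a
  function \<open>c\<close> below \<open>(a t + b t) ^ p\<close> avoids the integrability of that
  power; in the application \<open>c\<close> is the power of the norm of a sum.\<close>

lemma Minkowski_set_integral:
  fixes a b :: "'a \<Rightarrow> real"
  assumes int: "set_integrable M I (\<lambda>t. a t ^ p)" "set_integrable M I (\<lambda>t. b t ^ p)"
    "set_integrable M I c"
    and nonneg: "\<And>t. t \<in> I \<Longrightarrow> a t \<ge> 0" "\<And>t. t \<in> I \<Longrightarrow> b t \<ge> 0"
    and c: "\<And>t. t \<in> I \<Longrightarrow> c t \<le> (a t + b t) ^ p"
    and AB: "A > 0" "B > 0" "(LINT t:I|M. a t ^ p) \<le> A ^ p" "(LINT t:I|M. b t ^ p) \<le> B ^ p"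
  shows "(LINT t:I|M. c t) \<le> (A + B) ^ p"
proof -
  define u where "u = (A + B) ^ p * (A / (A + B)) / A ^ p"
  define v where "v = (A + B) ^ p * (B / (A + B)) / B ^ p"
  have uv: "u \<ge> 0" "v \<ge> 0" using AB by (auto simp: u_def v_def)
  have iu: "set_integrable M I (\<lambda>t. u * a t ^ p)" and iv: "set_integrable M I (\<lambda>t. v * b t ^ p)"
    using int by (auto intro: set_integrable_mult_right)
  have "(LINT t:I|M. c t) \<le> (LINT t:I|M. u * a t ^ p + v * b t ^ p)"
  proof (rule set_integral_mono)
    show "set_integrable M I (\<lambda>t. u * a t ^ p + v * b t ^ p)"
      by (rule set_integral_add(1)[OF iu iv])
    fix t assume "t \<in> I"
    from power_add_weighted_le[OF nonneg(1)[OF this] nonneg(2)[OF this] AB(1,2), of p] c[OF this]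
    show "c t \<le> u * a t ^ p + v * b t ^ p"
      by (simp add: u_def v_def power_divide distrib_left)
  qed (rule int(3))
  also have "\<dots> = u * (LINT t:I|M. a t ^ p) + v * (LINT t:I|M. b t ^ p)"
    by (simp only: set_integral_add(2)[OF iu iv] set_integral_mult_right)
  also have "\<dots> \<le> u * A ^ p + v * B ^ p"
    using AB uv by (intro add_mono mult_left_mono) auto
  also have "\<dots> = (A + B) ^ p * (A / (A + B) + B / (A + B))"
    using AB unfolding u_def v_def distrib_left by simp
  also have "A / (A + B) + B / (A + B) = 1"
    using AB by (simp flip: add_divide_distrib)
  finally show ?thesis by simp
qed

text \<open>These conditions make the real suprema in the seminorms genuine, that is, taken over
  nonempty sets that are bounded above.\<close>

definition bounded_pair :: "real set \<times> (real \<Rightarrow> real^'m) set \<Rightarrow> bool" where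
  "bounded_pair c \<longleftrightarrow> fst c \<in> rat_intervals \<and> snd c \<noteq> {} \<and> (\<exists>j. snd c \<subseteq> C_ball (fst c) j)"

lemma bounded_pairE:
  assumes "bounded_pair (I, \<Gamma>)"
  obtains j where "I \<in> rat_intervals" "\<Gamma> \<noteq> {}" "\<Gamma> \<subseteq> C_ball I j" "\<Gamma> \<subseteq> meas_curves I j"
  using assms C_ball_subset_meas_curves[of I] by (auto simp: bounded_pair_def)

lemma bdd_above_strong:
  fixes f :: "real \<times> (real^'m) \<Rightarrow> real^'n"
  assumes f: "f \<in> SC_fun p" and p: "p \<ge> 1" and b: "bounded_pair (I, \<Gamma>)"
  shows "bdd_above ((\<lambda>\<gamma>. LINT t:I|lebesgue. norm (f (t, \<gamma> t)) ^ p) ` \<Gamma>)"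
proof -
  obtain j where j: "I \<in> rat_intervals" "\<Gamma> \<subseteq> meas_curves I j"
    by (rule bounded_pairE[OF b]) (rule that)
  show ?thesis
  proof (rule SC_fun_along[OF f p j(1), where j = j])
    fix m assume "\<And>\<gamma>. \<gamma> \<in> meas_curves I j \<Longrightarrow>
      (LINT t:I|lebesgue. norm (f (t, \<gamma> t)) ^ p) \<le> (LINT t:I|lebesgue. \<bar>m t\<bar> ^ p)"
    then show ?thesis
      using j(2) by (intro bdd_aboveI2[of _ _ "LINT t:I|lebesgue. \<bar>m t\<bar> ^ p"]) blast
  qed
qed

lemma LINT_norm_power_nonneg: "(LINT t:I|M. norm (g t) ^ p) \<ge> 0"
  unfolding set_lebesgue_integral_def by (intro Bochner_Integration.integral_nonneg) simp

text \<open>\<open>root p\<close> is monotone on the whole line and cancels p-th powers of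
  nonnegative numbers, which suits the passage to suprema better than \<open>powr\<close>.\<close>

lemma strong_seminorm_root:
  assumes "p \<ge> 1"
  shows "strong_seminorm p (I, \<Gamma>) f = (SUP \<gamma>\<in>\<Gamma>. root p (LINT t:I|lebesgue. norm (f (t, \<gamma> t)) ^ p))"
  using assms by (simp add: strong_seminorm_def root_powr_inverse[OF _ LINT_norm_power_nonneg])

lemma strong_seminorm_upper:
  fixes f :: "real \<times> (real^'m) \<Rightarrow> real^'n"
  assumes f: "f \<in> SC_fun p" and p: "p \<ge> 1" and b: "bounded_pair (I, \<Gamma>)" and g: "\<gamma> \<in> \<Gamma>"
  shows "strong_seminorm p (I, \<Gamma>) f \<ge> 0"
    and "(LINT t:I|lebesgue. norm (f (t, \<gamma> t)) ^ p) \<le> strong_seminorm p (I, \<Gamma>) f ^ p"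
proof -
  let ?S = "\<lambda>\<gamma>. LINT t:I|lebesgue. norm (f (t, \<gamma> t)) ^ p"
  obtain B where B: "\<And>\<gamma>. \<gamma> \<in> \<Gamma> \<Longrightarrow> ?S \<gamma> \<le> B"
    using bdd_above_strong[OF f p b] by (auto simp: bdd_above_def)
  have "bdd_above ((\<lambda>\<gamma>. root p (?S \<gamma>)) ` \<Gamma>)"
    using B p by (intro bdd_aboveI2[of _ _ "root p B"]) simp
  then have le: "root p (?S \<gamma>) \<le> strong_seminorm p (I, \<Gamma>) f"
    unfolding strong_seminorm_root[OF p] by (rule cSUP_upper[OF g])
  have 0: "?S \<gamma> \<ge> 0" by (rule LINT_norm_power_nonneg)
  then have r0: "root p (?S \<gamma>) \<ge> 0" using p by simp
  then show "strong_seminorm p (I, \<Gamma>) f \<ge> 0" using le by linarith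
  have "?S \<gamma> = root p (?S \<gamma>) ^ p" using 0 p by simp
  also have "\<dots> \<le> strong_seminorm p (I, \<Gamma>) f ^ p" by (intro power_mono le r0)
  finally show "?S \<gamma> \<le> strong_seminorm p (I, \<Gamma>) f ^ p" .
qed

lemma strong_seminorm_least:
  assumes p: "p \<ge> 1" and "\<Gamma> \<noteq> {}" and "c \<ge> 0"
    and le: "\<And>\<gamma>. \<gamma> \<in> \<Gamma> \<Longrightarrow> (LINT t:I|lebesgue. norm (f (t, \<gamma> t)) ^ p) \<le> c ^ p"
  shows "strong_seminorm p (I, \<Gamma>) f \<le> c"
  unfolding strong_seminorm_root[OF p]
proof (rule cSUP_least[OF \<open>\<Gamma> \<noteq> {}\<close>])
  fix \<gamma> assume "\<gamma> \<in> \<Gamma>"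
  then have "root p (LINT t:I|lebesgue. norm (f (t, \<gamma> t)) ^ p) \<le> root p (c ^ p)"
    using p le by simp
  then show "root p (LINT t:I|lebesgue. norm (f (t, \<gamma> t)) ^ p) \<le> c"
    using p \<open>c \<ge> 0\<close> by (simp add: real_root_power_cancel)
qed

lemma strong_seminorm_zero:
  assumes "p \<ge> 1" "\<Gamma> \<noteq> {}"
  shows "strong_seminorm p (I, \<Gamma>) (\<lambda>z. 0) = 0"
  using assms by (simp add: strong_seminorm_root power_0_left)

lemma strong_seminorm_triangle:
  fixes f g h :: "real \<times> (real^'m) \<Rightarrow> real^'n"
  assumes f: "f \<in> SC_fun p" and g: "g \<in> SC_fun p" and h: "h \<in> SC_fun p"
    and hfg: "\<And>z. h z = f z + g z"
    and p: "p \<ge> 1" and b: "bounded_pair (I, \<Gamma>)"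
  shows "strong_seminorm p (I, \<Gamma>) h \<le> strong_seminorm p (I, \<Gamma>) f + strong_seminorm p (I, \<Gamma>) g"
\<comment> \<open>The Minkowski estimate asks for positive bounds, while a seminorm may vanish;
  \<open>e / 2\<close> is added to each, with \<open>e\<close> arbitrary.\<close>
proof (rule field_le_epsilon)
  fix e :: real assume "e > 0"
  obtain j where j: "I \<in> rat_intervals" "\<Gamma> \<noteq> {}" "\<Gamma> \<subseteq> C_ball I j" "\<Gamma> \<subseteq> meas_curves I j"
    by (rule bounded_pairE[OF b]) (rule that)
  obtain \<gamma>0 where "\<gamma>0 \<in> \<Gamma>" using j(2) by blast
  let ?A = "strong_seminorm p (I, \<Gamma>) f" and ?B = "strong_seminorm p (I, \<Gamma>) g"
  define A where "A = ?A + e / 2"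
  define B where "B = ?B + e / 2"
  have AB: "A > 0" "B > 0" "?A \<le> A" "?B \<le> B"
    using strong_seminorm_upper(1)[OF f p b \<open>\<gamma>0 \<in> \<Gamma>\<close>] strong_seminorm_upper(1)[OF g p b \<open>\<gamma>0 \<in> \<Gamma>\<close>] \<open>e > 0\<close>
    by (auto simp: A_def B_def)
  have "strong_seminorm p (I, \<Gamma>) h \<le> A + B"
  proof (rule strong_seminorm_least[OF p j(2)])
    fix \<gamma> assume \<gamma>: "\<gamma> \<in> \<Gamma>"
    then have \<gamma>m: "\<gamma> \<in> meas_curves I j" using j(4) by blast
    show "(LINT t:I|lebesgue. norm (h (t, \<gamma> t)) ^ p) \<le> (A + B) ^ p"
    proof (rule Minkowski_set_integral)
      show "norm (h (t, \<gamma> t)) ^ p \<le> (norm (f (t, \<gamma> t)) + norm (g (t, \<gamma> t))) ^ p" for t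
        unfolding hfg by (intro power_mono norm_triangle_ineq) simp
      show "(LINT t:I|lebesgue. norm (f (t, \<gamma> t)) ^ p) \<le> A ^ p"
        using strong_seminorm_upper[OF f p b \<gamma>] power_mono[OF AB(3), of p] by linarith
      show "(LINT t:I|lebesgue. norm (g (t, \<gamma> t)) ^ p) \<le> B ^ p"
        using strong_seminorm_upper[OF g p b \<gamma>] power_mono[OF AB(4), of p] by linarith
    qed (use AB set_integrable_norm_power[OF _ p j(1) \<gamma>m] f g h in auto)
  qed (use AB in auto)
  then show "strong_seminorm p (I, \<Gamma>) h \<le> ?A + ?B + e"
    by (simp add: A_def B_def)
qed

section \<open>Suprema and triangle inequality for the weak seminorms\<close>

lemma weak_seminorm_upper:
  fixes f :: "real \<times> (real^'m) \<Rightarrow> real^'n"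
  assumes f: "f \<in> SC_fun 1" and b: "bounded_pair (I, \<Gamma>)" and g: "\<gamma> \<in> \<Gamma>"
  shows "norm (LINT t:I|lebesgue. f (t, \<gamma> t)) \<le> weak_seminorm (I, \<Gamma>) f"
proof -
  obtain B where B: "\<And>\<gamma>. \<gamma> \<in> \<Gamma> \<Longrightarrow> (LINT t:I|lebesgue. norm (f (t, \<gamma> t)) ^ 1) \<le> B"
    using bdd_above_strong[OF f order_refl b] by (auto simp: bdd_above_def)
  have "bdd_above ((\<lambda>\<gamma>. norm (LINT t:I|lebesgue. f (t, \<gamma> t))) ` \<Gamma>)"
  proof (rule bdd_aboveI2)
    fix \<gamma> assume "\<gamma> \<in> \<Gamma>"
    then show "norm (LINT t:I|lebesgue. f (t, \<gamma> t)) \<le> B"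
      using norm_set_integral_le[of lebesgue I "\<lambda>t. f (t, \<gamma> t)"] B[of \<gamma>] by simp
  qed
  then show ?thesis
    unfolding weak_seminorm_def prod.case by (rule cSUP_upper[OF g])
qed

lemma weak_seminorm_least:
  assumes "\<Gamma> \<noteq> {}" and "\<And>\<gamma>. \<gamma> \<in> \<Gamma> \<Longrightarrow> norm (LINT t:I|lebesgue. f (t, \<gamma> t)) \<le> c"
  shows "weak_seminorm (I, \<Gamma>) f \<le> c"
  using assms unfolding weak_seminorm_def by (auto intro: cSUP_least)

lemma weak_seminorm_zero:
  assumes "\<Gamma> \<noteq> {}"
  shows "weak_seminorm (I, \<Gamma>) (\<lambda>z. 0) = 0"
  using assms by (simp add: weak_seminorm_def)

lemma weak_seminorm_triangle:
  fixes f g h :: "real \<times> (real^'m) \<Rightarrow> real^'n"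
  assumes f: "f \<in> SC_fun 1" and g: "g \<in> SC_fun 1"
    and hfg: "\<And>z. h z = f z + g z" and b: "bounded_pair (I, \<Gamma>)"
  shows "weak_seminorm (I, \<Gamma>) h \<le> weak_seminorm (I, \<Gamma>) f + weak_seminorm (I, \<Gamma>) g"
proof -
  obtain j where j: "I \<in> rat_intervals" "\<Gamma> \<noteq> {}" "\<Gamma> \<subseteq> C_ball I j" "\<Gamma> \<subseteq> meas_curves I j"
    by (rule bounded_pairE[OF b]) (rule that)
  show ?thesis
  proof (rule weak_seminorm_least[OF j(2)])
    fix \<gamma> assume \<gamma>: "\<gamma> \<in> \<Gamma>"
    then have \<gamma>m: "\<gamma> \<in> meas_curves I j" using j(4) by blast
    have "(LINT t:I|lebesgue. h (t, \<gamma> t)) = (LINT t:I|lebesgue. f (t, \<gamma> t)) + (LINT t:I|lebesgue. g (t, \<gamma> t))"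
      unfolding hfg by (intro set_integral_add(2) set_integrable_along[OF f j(1) \<gamma>m] set_integrable_along[OF g j(1) \<gamma>m])
    then show "norm (LINT t:I|lebesgue. h (t, \<gamma> t)) \<le> weak_seminorm (I, \<Gamma>) f + weak_seminorm (I, \<Gamma>) g"
      using norm_triangle_ineq[of "LINT t:I|lebesgue. f (t, \<gamma> t)" "LINT t:I|lebesgue. g (t, \<gamma> t)"]
        weak_seminorm_upper[OF f b \<gamma>] weak_seminorm_upper[OF g b \<gamma>] by simp
  qed
qed

section \<open>Conditions on families of curves and the comparison of two families\<close>

definition equicontinuous_pair :: "real set \<times> (real \<Rightarrow> real^'m) set \<Rightarrow> bool" where
  "equicontinuous_pair c \<longleftrightarrow> (\<forall>\<epsilon>>0. \<exists>\<delta>>0. \<forall>\<gamma>\<in>snd c. \<forall>s\<in>fst c. \<forall>t\<in>fst c.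
     \<bar>t - s\<bar> < \<delta> \<longrightarrow> norm (\<gamma> t - \<gamma> s) \<le> \<epsilon>)"

text \<open>A seminorm over a set containing the constant curve \<open>x\<close> dominates the
  pointwise seminorm at \<open>x\<close>. The dense set is existential because it varies with the
  family; \<open>\<Gamma>\<close> may depend on \<open>I\<close> and \<open>x\<close>, since the
  ball in question must be large enough to contain \<open>x\<close>.\<close>

definition dense_constants :: "(real set \<times> (real \<Rightarrow> real^'m) set) set \<Rightarrow> bool" where
  "dense_constants \<C> \<longleftrightarrow> (\<exists>D. closure D = UNIV \<and>
     (\<forall>I\<in>rat_intervals. \<forall>x\<in>D. \<exists>\<Gamma>. (I, \<Gamma>) \<in> \<C> \<and> (\<lambda>t. x) \<in> \<Gamma>))"

lemma dense_constantsE: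
  assumes "dense_constants \<C>"
  obtains D \<Gamma>' where "closure D = UNIV"
    "\<forall>I\<in>rat_intervals. \<forall>x\<in>D. (I, \<Gamma>' I x) \<in> \<C> \<and> (\<lambda>t. x) \<in> \<Gamma>' I x"
proof -
  obtain D where D: "closure D = UNIV"
    "\<forall>I\<in>rat_intervals. \<forall>x\<in>D. \<exists>\<Gamma>. (I, \<Gamma>) \<in> \<C> \<and> (\<lambda>t. x) \<in> \<Gamma>"
    using assms unfolding dense_constants_def by (elim exE conjE)
  define \<Gamma>' where "\<Gamma>' I x = (SOME \<Gamma>. (I, \<Gamma>) \<in> \<C> \<and> (\<lambda>t. x) \<in> \<Gamma>)" for I x
  have "\<forall>I\<in>rat_intervals. \<forall>x\<in>D. (I, \<Gamma>' I x) \<in> \<C> \<and> (\<lambda>t. x) \<in> \<Gamma>' I x"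
  proof (intro ballI)
    fix I x assume "I \<in> rat_intervals" "x \<in> D"
    then have "\<exists>\<Gamma>. (I, \<Gamma>) \<in> \<C> \<and> (\<lambda>t. x) \<in> \<Gamma>" using D(2) by simp
    then show "(I, \<Gamma>' I x) \<in> \<C> \<and> (\<lambda>t. x) \<in> \<Gamma>' I x"
      unfolding \<Gamma>'_def by (rule someI_ex)
  qed
  with D(1) show ?thesis by (rule that)
qed

lemma dense_constants_nonempty: "dense_constants \<C> \<Longrightarrow> \<C> \<noteq> {}"
proof -
  assume "dense_constants \<C>"
  then obtain D \<Gamma>' where D: "closure D = UNIV"
    "\<forall>I\<in>rat_intervals. \<forall>x\<in>D. (I, \<Gamma>' I x) \<in> \<C> \<and> (\<lambda>t. x) \<in> \<Gamma>' I x"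
    by (rule dense_constantsE)
  have "{0..0} \<in> rat_intervals"
    unfolding rat_intervals_def by (intro CollectI exI[of _ 0]) simp
  moreover have "D \<noteq> {}" using D(1) by auto
  ultimately show ?thesis using D(2) by blast
qed

lemma strong_seminorm_image_zero:
  assumes p: "p \<ge> 1" and b: "\<forall>c\<in>\<C>. bounded_pair c" and \<rho>: "\<rho> \<in> strong_seminorm p ` \<C>"
  shows "\<rho> (\<lambda>z. 0) = 0"
proof -
  obtain I \<Gamma> where c: "(I, \<Gamma>) \<in> \<C>" "\<rho> = strong_seminorm p (I, \<Gamma>)" using \<rho> by auto
  then have "\<Gamma> \<noteq> {}" using bspec[OF b c(1)] by (simp add: bounded_pair_def)
  then show ?thesis unfolding c(2) by (rule strong_seminorm_zero[OF p])
qed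

lemma weak_seminorm_image_zero:
  assumes b: "\<forall>c\<in>\<C>. bounded_pair c" and \<rho>: "\<rho> \<in> weak_seminorm ` \<C>"
  shows "\<rho> (\<lambda>z. 0) = 0"
proof -
  obtain I \<Gamma> where c: "(I, \<Gamma>) \<in> \<C>" "\<rho> = weak_seminorm (I, \<Gamma>)" using \<rho> by auto
  then have "\<Gamma> \<noteq> {}" using bspec[OF b c(1)] by (simp add: bounded_pair_def)
  then show ?thesis unfolding c(2) by (rule weak_seminorm_zero)
qed

text \<open>The two families play different roles. The seminorms of \<open>\<C>1\<close> are
  estimated, which rests on their curves being measurable with values in a ball; those of
  \<open>\<C>2\<close> do the estimating, being finite and dominating pointwise seminorms over a
  dense set.\<close>

lemma strong_topology_refine:
  fixes E :: "(real \<times> (real^'m) \<Rightarrow> real^'n) set set"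
  assumes p: "p \<ge> 1" and E: "E \<subseteq> SC p" and l: "Lq_loc_bounded_lbounds p E"
    and C1: "\<C>1 \<noteq> {}" "\<forall>c\<in>\<C>1. bounded_pair c"
    and C2: "dense_constants \<C>2" "\<forall>c\<in>\<C>2. bounded_pair c"
    and U: "openin (strong_topology p \<C>1) U" "F \<in> U"
  shows "\<exists>V. openin (strong_topology p \<C>2) V \<and> F \<in> V \<and> V \<inter> E \<subseteq> U"
  unfolding strong_topology_def
proof (rule seminorm_topology_refine[OF _ _ _ _ E _ U[unfolded strong_topology_def]])
  fix \<rho> :: "(real \<times> (real^'m) \<Rightarrow> real^'n) \<Rightarrow> real" and F :: "(real \<times> (real^'m) \<Rightarrow> real^'n) set" and \<epsilon> :: real
  assume \<rho>: "\<rho> \<in> strong_seminorm p ` \<C>1" and F: "F \<in> SC p" and e: "\<epsilon> > 0"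
  obtain I \<Gamma> where c: "(I, \<Gamma>) \<in> \<C>1" "\<rho> = strong_seminorm p (I, \<Gamma>)" using \<rho> by auto
  have b: "bounded_pair (I, \<Gamma>)" using c(1) C1(2) by blast
  obtain j where j: "I \<in> rat_intervals" "\<Gamma> \<noteq> {}" "\<Gamma> \<subseteq> C_ball I j" "\<Gamma> \<subseteq> meas_curves I j"
    by (rule bounded_pairE[OF b]) (rule that)
  obtain D \<Gamma>' where D: "closure D = UNIV"
    "\<forall>I\<in>rat_intervals. \<forall>x\<in>D. (I, \<Gamma>' I x) \<in> \<C>2 \<and> (\<lambda>t. x) \<in> \<Gamma>' I x"
    by (rule dense_constantsE[OF C2(1)]) (rule that)
  \<comment> \<open>The supremum of the estimates yields only a weak inequality, hence
    \<open>\<epsilon> / 2\<close>; the power anticipates the root.\<close>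
  have e2: "(\<epsilon> / 2) ^ p > 0" using e by simp
  obtain X \<delta> where X: "finite X" "X \<subseteq> D" "\<delta> > 0"
    "\<forall>G\<in>E. (\<forall>x\<in>X. (LINT t:I|lebesgue. norm (repr G (t, x) - repr F (t, x)) ^ p) \<le> \<delta>) \<longrightarrow>
      (\<forall>\<gamma>\<in>meas_curves I j. (LINT t:I|lebesgue. norm (repr G (t, \<gamma> t) - repr F (t, \<gamma> t)) ^ p) \<le> (\<epsilon> / 2) ^ p)"
    by (rule strong_approximation[OF p E l F j(1) D(1) e2, where j = j]) (rule that)
  \<comment> \<open>A seminorm below \<open>d\<close> bounds the integral by \<open>d ^ p\<close>,
    and the cap 1 gives \<open>d ^ p \<le> d \<le> \<delta>\<close>.\<close>
  define d where "d = min 1 \<delta>"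
  have d: "d > 0" "d ^ p \<le> \<delta>"
  proof -
    show "d > 0" using X(3) by (simp add: d_def)
    then have "d ^ p \<le> d ^ 1" using p by (intro power_decreasing) (auto simp: d_def)
    then show "d ^ p \<le> \<delta>" by (simp add: d_def)
  qed
  show "\<exists>Q' \<delta>. finite Q' \<and> Q' \<subseteq> strong_seminorm p ` \<C>2 \<and> 0 < \<delta> \<and>
    (\<forall>G\<in>E. (\<forall>\<rho>'\<in>Q'. \<rho>' (\<lambda>z. repr G z - repr F z) < \<delta>) \<longrightarrow> \<rho> (\<lambda>z. repr G z - repr F z) < \<epsilon>)"
  proof (intro exI[of _ "(\<lambda>x. strong_seminorm p (I, \<Gamma>' I x)) ` X"] exI[of _ d] conjI ballI impI)
    show "finite ((\<lambda>x. strong_seminorm p (I, \<Gamma>' I x)) ` X)" using X(1) by simp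
    show "(\<lambda>x. strong_seminorm p (I, \<Gamma>' I x)) ` X \<subseteq> strong_seminorm p ` \<C>2"
      using D(2) X(2) j(1) by blast
    fix G assume G: "G \<in> E"
      and small: "\<forall>\<rho>'\<in>(\<lambda>x. strong_seminorm p (I, \<Gamma>' I x)) ` X. \<rho>' (\<lambda>z. repr G z - repr F z) < d"
    have h: "(\<lambda>z. repr G z - repr F z) \<in> SC_fun p"
      using E G F by (intro SC_fun_diff repr_in_SC_fun[OF p]) auto
    have "(LINT t:I|lebesgue. norm (repr G (t, x) - repr F (t, x)) ^ p) \<le> \<delta>" if x: "x \<in> X" for x
    proof -
      have m: "(I, \<Gamma>' I x) \<in> \<C>2" "(\<lambda>t. x) \<in> \<Gamma>' I x" using D(2) X(2) j(1) x by auto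
      note up = strong_seminorm_upper[OF h p bspec[OF C2(2) m(1)] m(2)]
      have "strong_seminorm p (I, \<Gamma>' I x) (\<lambda>z. repr G z - repr F z) < d" using small x by simp
      then have "strong_seminorm p (I, \<Gamma>' I x) (\<lambda>z. repr G z - repr F z) ^ p \<le> d ^ p"
        using up(1) by (intro power_mono) auto
      with up(2) d(2) show ?thesis by linarith
    qed
    then have "(LINT t:I|lebesgue. norm (repr G (t, \<gamma> t) - repr F (t, \<gamma> t)) ^ p) \<le> (\<epsilon> / 2) ^ p"
      if "\<gamma> \<in> \<Gamma>" for \<gamma>
      using X(4) G j(4) that by blast
    then have "strong_seminorm p (I, \<Gamma>) (\<lambda>z. repr G z - repr F z) \<le> \<epsilon> / 2"
      using e by (intro strong_seminorm_least[OF p j(2)]) auto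
    then show "\<rho> (\<lambda>z. repr G z - repr F z) < \<epsilon>"
      using e by (simp add: c(2))
  qed (rule d(1))
next
  fix \<rho> :: "(real \<times> (real^'m) \<Rightarrow> real^'n) \<Rightarrow> real" and F G H :: "(real \<times> (real^'m) \<Rightarrow> real^'n) set"
  assume \<rho>: "\<rho> \<in> strong_seminorm p ` \<C>1" and FGH: "F \<in> SC p" "G \<in> SC p" "H \<in> SC p"
  obtain I \<Gamma> where c: "(I, \<Gamma>) \<in> \<C>1" "\<rho> = strong_seminorm p (I, \<Gamma>)" using \<rho> by auto
  show "\<rho> (\<lambda>z. repr H z - repr F z) \<le> \<rho> (\<lambda>z. repr H z - repr G z) + \<rho> (\<lambda>z. repr G z - repr F z)"
    unfolding c(2)
    by (rule strong_seminorm_triangle[OF _ _ _ _ p bspec[OF C1(2) c(1)]])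
      (use FGH in \<open>auto intro!: SC_fun_diff repr_in_SC_fun[OF p]\<close>)
next
  fix \<rho> :: "(real \<times> (real^'m) \<Rightarrow> real^'n) \<Rightarrow> real"
  assume "\<rho> \<in> strong_seminorm p ` \<C>2"
  then show "\<rho> (\<lambda>z. 0) = 0" by (rule strong_seminorm_image_zero[OF p C2(2)])
qed (use C1(1) dense_constants_nonempty[OF C2(1)] in auto)

text \<open>Equicontinuity belongs to the family being estimated, \<open>\<C>1\<close>. The estimate
  may involve seminorms of \<open>\<C>2\<close> over intervals other than \<open>I\<close>, which is
  why \<open>dense_constants\<close> provides the constants on every rational interval.\<close>

lemma weak_topology_refine:
  fixes E :: "(real \<times> (real^'m) \<Rightarrow> real^'n) set set"
  assumes E: "E \<subseteq> SC 1" and l: "Lq_loc_bounded_lbounds 1 E"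
    and C1: "\<C>1 \<noteq> {}" "\<forall>c\<in>\<C>1. bounded_pair c \<and> equicontinuous_pair c"
    and C2: "dense_constants \<C>2" "\<forall>c\<in>\<C>2. bounded_pair c"
    and U: "openin (weak_topology \<C>1) U" "F \<in> U"
  shows "\<exists>V. openin (weak_topology \<C>2) V \<and> F \<in> V \<and> V \<inter> E \<subseteq> U"
  unfolding weak_topology_def
proof (rule seminorm_topology_refine[OF _ _ _ _ E _ U[unfolded weak_topology_def]])
  fix \<rho> :: "(real \<times> (real^'m) \<Rightarrow> real^'n) \<Rightarrow> real" and F :: "(real \<times> (real^'m) \<Rightarrow> real^'n) set" and \<epsilon> :: real
  assume \<rho>: "\<rho> \<in> weak_seminorm ` \<C>1" and F: "F \<in> SC 1" and e: "\<epsilon> > 0"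
  obtain I \<Gamma> where c: "(I, \<Gamma>) \<in> \<C>1" "\<rho> = weak_seminorm (I, \<Gamma>)" using \<rho> by auto
  have b: "bounded_pair (I, \<Gamma>)" "equicontinuous_pair (I, \<Gamma>)" using c(1) C1(2) by blast+
  obtain j where j: "I \<in> rat_intervals" "\<Gamma> \<noteq> {}" "\<Gamma> \<subseteq> C_ball I j" "\<Gamma> \<subseteq> meas_curves I j"
    by (rule bounded_pairE[OF b(1)]) (rule that)
  obtain D \<Gamma>' where D: "closure D = UNIV"
    "\<forall>I\<in>rat_intervals. \<forall>x\<in>D. (I, \<Gamma>' I x) \<in> \<C>2 \<and> (\<lambda>t. x) \<in> \<Gamma>' I x"
    by (rule dense_constantsE[OF C2(1)]) (rule that)
  have e2: "\<epsilon> / 2 > 0" using e by simp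
  have equi: "\<exists>\<delta>>0. \<forall>\<gamma>\<in>\<Gamma>. \<forall>s\<in>I. \<forall>t\<in>I. \<bar>t - s\<bar> < \<delta> \<longrightarrow> norm (\<gamma> t - \<gamma> s) \<le> \<epsilon>" if "\<epsilon> > 0" for \<epsilon>
    using b(2) that by (simp add: equicontinuous_pair_def)
  obtain Q \<delta> where Q: "finite Q" "Q \<subseteq> rat_intervals \<times> D" "\<delta> > 0"
    "\<forall>G\<in>E. (\<forall>(J, x)\<in>Q. norm (LINT t:J|lebesgue. repr G (t, x) - repr F (t, x)) \<le> \<delta>) \<longrightarrow>
      (\<forall>\<gamma>\<in>\<Gamma>. norm (LINT t:I|lebesgue. repr G (t, \<gamma> t) - repr F (t, \<gamma> t)) \<le> \<epsilon> / 2)"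
    by (rule weak_approximation[OF E l F j(1) D(1) e2 j(3) equi]) (assumption, rule that)
  let ?\<rho> = "\<lambda>(J, x). weak_seminorm (J, \<Gamma>' J x)"
  show "\<exists>Q' \<delta>. finite Q' \<and> Q' \<subseteq> weak_seminorm ` \<C>2 \<and> 0 < \<delta> \<and>
    (\<forall>G\<in>E. (\<forall>\<rho>'\<in>Q'. \<rho>' (\<lambda>z. repr G z - repr F z) < \<delta>) \<longrightarrow> \<rho> (\<lambda>z. repr G z - repr F z) < \<epsilon>)"
  proof (intro exI[of _ "?\<rho> ` Q"] exI[of _ \<delta>] conjI ballI impI)
    show "finite (?\<rho> ` Q)" using Q(1) by simp
    show "?\<rho> ` Q \<subseteq> weak_seminorm ` \<C>2"
    proof (intro image_subsetI)
      fix q assume "q \<in> Q"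
      then have "fst q \<in> rat_intervals" "snd q \<in> D" using Q(2) by auto
      then have "(fst q, \<Gamma>' (fst q) (snd q)) \<in> \<C>2" using D(2) by blast
      then show "?\<rho> q \<in> weak_seminorm ` \<C>2" by (simp add: case_prod_beta)
    qed
    fix G assume G: "G \<in> E"
      and small: "\<forall>\<rho>'\<in>?\<rho> ` Q. \<rho>' (\<lambda>z. repr G z - repr F z) < \<delta>"
    have h: "(\<lambda>z. repr G z - repr F z) \<in> SC_fun 1"
      using E G F by (intro SC_fun_diff repr_in_SC_fun[OF order_refl]) auto
    have "norm (LINT t:J|lebesgue. repr G (t, x) - repr F (t, x)) \<le> \<delta>" if x: "(J, x) \<in> Q" for J x
    proof -
      have m: "(J, \<Gamma>' J x) \<in> \<C>2" "(\<lambda>t. x) \<in> \<Gamma>' J x" using D(2) Q(2) x by auto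
      have "?\<rho> (J, x) (\<lambda>z. repr G z - repr F z) < \<delta>" using small x by blast
      with weak_seminorm_upper[OF h bspec[OF C2(2) m(1)] m(2)] show ?thesis by simp
    qed
    then have "norm (LINT t:I|lebesgue. repr G (t, \<gamma> t) - repr F (t, \<gamma> t)) \<le> \<epsilon> / 2" if "\<gamma> \<in> \<Gamma>" for \<gamma>
      using Q(4) G that by blast
    then have "weak_seminorm (I, \<Gamma>) (\<lambda>z. repr G z - repr F z) \<le> \<epsilon> / 2"
      by (intro weak_seminorm_least[OF j(2)])
    then show "\<rho> (\<lambda>z. repr G z - repr F z) < \<epsilon>"
      using e by (simp add: c(2))
  qed (rule Q(3))
next
  fix \<rho> :: "(real \<times> (real^'m) \<Rightarrow> real^'n) \<Rightarrow> real" and F G H :: "(real \<times> (real^'m) \<Rightarrow> real^'n) set"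
  assume \<rho>: "\<rho> \<in> weak_seminorm ` \<C>1" and FGH: "F \<in> SC 1" "G \<in> SC 1" "H \<in> SC 1"
  obtain I \<Gamma> where c: "(I, \<Gamma>) \<in> \<C>1" "\<rho> = weak_seminorm (I, \<Gamma>)" using \<rho> by auto
  have b: "bounded_pair (I, \<Gamma>)" using c(1) C1(2) by blast
  show "\<rho> (\<lambda>z. repr H z - repr F z) \<le> \<rho> (\<lambda>z. repr H z - repr G z) + \<rho> (\<lambda>z. repr G z - repr F z)"
    unfolding c(2)
    by (rule weak_seminorm_triangle[OF _ _ _ b])
      (intro SC_fun_diff repr_in_SC_fun[OF order_refl] FGH | simp)+
next
  fix \<rho> :: "(real \<times> (real^'m) \<Rightarrow> real^'n) \<Rightarrow> real"
  assume "\<rho> \<in> weak_seminorm ` \<C>2"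
  then show "\<rho> (\<lambda>z. 0) = 0" by (rule weak_seminorm_image_zero[OF C2(2)])
qed (use C1(1) dense_constants_nonempty[OF C2(1)] in auto)

section \<open>Equality of the induced topologies and of the closures\<close>

lemma strong_topologies_agree:
  fixes E :: "(real \<times> (real^'m) \<Rightarrow> real^'n) set set"
  assumes p: "p \<ge> 1" and E: "E \<subseteq> SC p" and l: "Lq_loc_bounded_lbounds p E"
    and C1: "dense_constants \<C>1" "\<forall>c\<in>\<C>1. bounded_pair c"
    and C2: "dense_constants \<C>2" "\<forall>c\<in>\<C>2. bounded_pair c"
  shows "subtopology (strong_topology p \<C>1) E = subtopology (strong_topology p \<C>2) E"
    and "strong_topology p \<C>1 closure_of E = strong_topology p \<C>2 closure_of E"
proof -
  have top: "topspace (strong_topology p \<C> :: (real \<times> (real^'m) \<Rightarrow> real^'n) set topology) = SC p"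
    if "dense_constants \<C>" "\<forall>c\<in>\<C>. bounded_pair c" for \<C>
    unfolding strong_topology_def
  proof (rule topspace_seminorm_topology)
    fix \<rho> :: "(real \<times> (real^'m) \<Rightarrow> real^'n) \<Rightarrow> real"
    assume "\<rho> \<in> strong_seminorm p ` \<C>"
    then show "\<rho> (\<lambda>z. 0) = 0" by (rule strong_seminorm_image_zero[OF p that(2)])
  qed (use dense_constants_nonempty[OF that(1)] in simp)
  note eq = trans[OF top[OF C1] top[OF C2, symmetric]]
  note a = subtopology_closure_of_subset[OF eq
      strong_topology_refine[OF p E l dense_constants_nonempty[OF C1(1)] C1(2) C2]]
  note b = subtopology_closure_of_subset[OF eq[symmetric]
      strong_topology_refine[OF p E l dense_constants_nonempty[OF C2(1)] C2(2) C1]]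
  show "subtopology (strong_topology p \<C>1) E = subtopology (strong_topology p \<C>2) E"
    unfolding topology_eq using a(1) b(1) by blast
  show "strong_topology p \<C>1 closure_of E = strong_topology p \<C>2 closure_of E"
    using a(2) b(2) by (intro equalityI)
qed

lemma weak_topologies_agree:
  fixes E :: "(real \<times> (real^'m) \<Rightarrow> real^'n) set set"
  assumes E: "E \<subseteq> SC 1" and l: "Lq_loc_bounded_lbounds 1 E"
    and C1: "dense_constants \<C>1" "\<forall>c\<in>\<C>1. bounded_pair c \<and> equicontinuous_pair c"
    and C2: "dense_constants \<C>2" "\<forall>c\<in>\<C>2. bounded_pair c \<and> equicontinuous_pair c"
  shows "subtopology (weak_topology \<C>1) E = subtopology (weak_topology \<C>2) E"
    and "weak_topology \<C>1 closure_of E = weak_topology \<C>2 closure_of E"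
proof -
  have b1: "\<forall>c\<in>\<C>1. bounded_pair c" and b2: "\<forall>c\<in>\<C>2. bounded_pair c"
    using C1(2) C2(2) by auto
  have top: "topspace (weak_topology \<C> :: (real \<times> (real^'m) \<Rightarrow> real^'n) set topology) = SC 1"
    if "dense_constants \<C>" "\<forall>c\<in>\<C>. bounded_pair c" for \<C>
    unfolding weak_topology_def
  proof (rule topspace_seminorm_topology)
    fix \<rho> :: "(real \<times> (real^'m) \<Rightarrow> real^'n) \<Rightarrow> real"
    assume "\<rho> \<in> weak_seminorm ` \<C>"
    then show "\<rho> (\<lambda>z. 0) = 0" by (rule weak_seminorm_image_zero[OF that(2)])
  qed (use dense_constants_nonempty[OF that(1)] in simp)
  note eq = trans[OF top[OF C1(1) b1] top[OF C2(1) b2, symmetric]]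
  note a = subtopology_closure_of_subset[OF eq
      weak_topology_refine[OF E l dense_constants_nonempty[OF C1(1)] C1(2) C2(1) b2]]
  note b = subtopology_closure_of_subset[OF eq[symmetric]
      weak_topology_refine[OF E l dense_constants_nonempty[OF C2(1)] C2(2) C1(1) b1]]
  show "subtopology (weak_topology \<C>1) E = subtopology (weak_topology \<C>2) E"
    unfolding topology_eq using a(1) b(1) by blast
  show "weak_topology \<C>1 closure_of E = weak_topology \<C>2 closure_of E"
    using a(2) b(2) by (intro equalityI)
qed

section \<open>The families of curves\<close>

lemma norm_le_nat: "norm x \<le> real (nat \<lceil>norm x\<rceil>)"
  by linarith

lemma const_in_C_ball: "norm x \<le> real j \<Longrightarrow> (\<lambda>t. x) \<in> C_ball I j"
  by (auto simp: C_ball_def)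

text \<open>The moduli are nonnegative because they are monotone and vanish at 0.\<close>

lemma const_in_K_mod:
  assumes th: "suitable_moduli \<theta>" and I: "I \<in> rat_intervals" and x: "norm x \<le> real j"
  shows "(\<lambda>t. x) \<in> K_mod \<theta> I j"
proof -
  have "mono_on {0..} (\<theta> I j)" "\<theta> I j 0 = 0"
    using th I by (simp_all add: suitable_moduli_def)
  then have "0 \<le> \<theta> I j r" if "r \<ge> 0" for r
    using that by (metis atLeast_iff mono_onD order_refl)
  then show ?thesis
    using const_in_C_ball[OF x, of I] by (simp add: K_mod_def)
qed

lemma K_mod_subset_C_ball: "K_mod \<theta> I j \<subseteq> C_ball I j"
  by (auto simp: K_mod_def)

lemma equicontinuous_K_mod:
  assumes th: "suitable_moduli \<theta>" and I: "I \<in> rat_intervals"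
  shows "equicontinuous_pair (I, K_mod \<theta> I j)"
  unfolding equicontinuous_pair_def fst_conv snd_conv
proof (intro allI impI)
  fix \<epsilon> :: real assume "\<epsilon> > 0"
  have "continuous_on {0..} (\<theta> I j)" "\<theta> I j 0 = 0"
    using th I by (simp_all add: suitable_moduli_def)
  then have "\<forall>\<epsilon>>0. \<exists>\<delta>>0. \<forall>r\<in>{0..}. r < \<delta> \<longrightarrow> \<bar>\<theta> I j r\<bar> < \<epsilon>"
    unfolding continuous_on_iff by (auto simp: dist_real_def dest!: bspec[of _ _ 0])
  then obtain d where d: "d > 0" "\<forall>r\<in>{0..}. r < d \<longrightarrow> \<bar>\<theta> I j r\<bar> < \<epsilon>"
    using \<open>\<epsilon> > 0\<close> by meson
  show "\<exists>\<delta>>0. \<forall>\<gamma>\<in>K_mod \<theta> I j. \<forall>s\<in>I. \<forall>t\<in>I. \<bar>t - s\<bar> < \<delta> \<longrightarrow> norm (\<gamma> t - \<gamma> s) \<le> \<epsilon>"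
  proof (intro exI[of _ d] conjI ballI impI)
    fix \<gamma> s t assume "\<gamma> \<in> K_mod \<theta> I j" "s \<in> I" "t \<in> I" "\<bar>t - s\<bar> < d"
    then have "norm (\<gamma> t - \<gamma> s) \<le> \<theta> I j \<bar>t - s\<bar>" "\<bar>\<theta> I j \<bar>t - s\<bar>\<bar> < \<epsilon>"
      using d(2) by (auto simp: K_mod_def)
    then show "norm (\<gamma> t - \<gamma> s) \<le> \<epsilon>" by linarith
  qed (rule d(1))
qed

lemma equicontinuous_const: "equicontinuous_pair (I, {\<lambda>t. x})"
  unfolding equicontinuous_pair_def by (intro allI impI exI[of _ 1]) simp

lemma shift_back_rat_intervals:
  assumes "I \<in> rat_intervals"
  shows "shift_back I \<in> rat_intervals"
proof -
  obtain a b where ab: "I = {a..b}" "a \<in> \<rat>" "b \<in> \<rat>" "a \<le> b"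
    using assms by (auto simp: rat_intervals_def)
  then have "shift_back I = {a - 1..b - 1}" "a - 1 \<in> \<rat>" "b - 1 \<in> \<rat>" "a - 1 \<le> b - 1"
    by (auto intro: Rats_diff)
  then show ?thesis unfolding rat_intervals_def by blast
qed

lemma shifted_curve_in_C_ball:
  assumes "u \<in> C_ball (shift_back I) j"
  shows "(\<lambda>t. u (t - 1)) \<in> C_ball I j"
proof -
  have "continuous_on I (\<lambda>t. u (t - 1))"
    by (rule continuous_on_compose2[of "shift_back I" u])
      (use assms in \<open>auto simp: C_ball_def intro!: continuous_on_diff\<close>)
  moreover have "(\<lambda>t. u (t - 1)) ` I \<subseteq> cball 0 (real j)"
    using assms by (auto simp: C_ball_def)
  ultimately show ?thesis by (simp add: C_ball_def)
qed

lemma equicontinuous_shift: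
  assumes "equicontinuous_pair (shift_back I, B)"
  shows "equicontinuous_pair (I, (\<lambda>u t. u (t - 1)) ` B)"
  unfolding equicontinuous_pair_def fst_conv snd_conv
proof (intro allI impI)
  fix \<epsilon> :: real assume "\<epsilon> > 0"
  then obtain d where d: "d > 0"
    "\<forall>u\<in>B. \<forall>s\<in>shift_back I. \<forall>t\<in>shift_back I. \<bar>t - s\<bar> < d \<longrightarrow> norm (u t - u s) \<le> \<epsilon>"
    using assms unfolding equicontinuous_pair_def fst_conv snd_conv by metis
  show "\<exists>\<delta>>0. \<forall>\<gamma>\<in>(\<lambda>u t. u (t - 1)) ` B. \<forall>s\<in>I. \<forall>t\<in>I. \<bar>t - s\<bar> < \<delta> \<longrightarrow> norm (\<gamma> t - \<gamma> s) \<le> \<epsilon>"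
    using d by (intro exI[of _ d]) auto
qed

section \<open>Pairs as points of the big space and curves of pairs\<close>

lemma norm_pt_le:
  fixes e :: "'n::finite + 'n \<Rightarrow> 'm::finite"
  shows "norm (pt e x u) \<le> real CARD('m) * (norm x + norm u)"
proof -
  have "\<bar>pt e x u $ i\<bar> \<le> norm x + norm u" for i
    using component_le_norm_cart[of x] component_le_norm_cart[of u]
    by (auto simp: pt_def split: sum.split intro: add_increasing add_increasing2)
  \<comment> \<open>The l1 norm is precise enough: the constant \<open>CARD('m)\<close> only
    enlarges a ball or rescales an oscillation.\<close>
  then have "(\<Sum>i\<in>UNIV. \<bar>pt e x u $ i\<bar>) \<le> (\<Sum>i\<in>(UNIV::'m set). norm x + norm u)"
    by (intro sum_mono)
  then show ?thesis
    using norm_le_l1_cart[of "pt e x u"] by simp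
qed

lemma pt_diff: "pt e x u - pt e y v = pt e (x - y) (u - v)"
  by (simp add: vec_eq_iff pt_def split: sum.split)

text \<open>Every index of \<open>z\<close> is \<open>e (Inl k)\<close> or \<open>e (Inr k)\<close>
  for some \<open>k\<close>, so reading off these coordinates recovers both components.\<close>

lemma pt_surj:
  assumes "bij e"
  shows "\<exists>x u. z = pt e x u"
proof (intro exI)
  show "z = pt e (\<chi> k. z $ e (Inl k)) (\<chi> k. z $ e (Inr k))"
    unfolding vec_eq_iff
  proof
    fix i
    have i: "e (inv e i) = i" using assms by (simp add: bij_is_surj surj_f_inv_f)
    then show "z $ i = pt e (\<chi> k. z $ e (Inl k)) (\<chi> k. z $ e (Inr k)) $ i"
      by (auto simp: pt_def split: sum.split)
  qed
qed

lemma continuous_on_pt: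
  assumes "continuous_on I x" "continuous_on I u"
  shows "continuous_on I (\<lambda>t. pt e (x t) (u t))"
  unfolding pt_def
proof (rule continuous_on_vec_lambda)
  show "continuous_on I (\<lambda>t. case inv e i of Inl k \<Rightarrow> x t $ k | Inr k \<Rightarrow> u t $ k)" for i
    using assms by (cases "inv e i") (auto intro!: continuous_intros)
qed

text \<open>Common shape of the hybrid families, with the two components chosen independently. A
  fixed \<open>u\<close> becomes a singleton of a constant curve, and the delay is absorbed into the
  second set, so that both components live on \<open>I\<close>.\<close>

definition pt_curves ::
    "('n::finite + 'n \<Rightarrow> 'm) \<Rightarrow> (real \<Rightarrow> real^'n) set \<Rightarrow> (real \<Rightarrow> real^'n) set \<Rightarrow> (real \<Rightarrow> real^'m) set" where
  "pt_curves e A B = {\<lambda>t. pt e (x t) (u t) | x u. x \<in> A \<and> u \<in> B}"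

lemma pt_curvesI: "(\<lambda>t. x) \<in> A \<Longrightarrow> (\<lambda>t. u) \<in> B \<Longrightarrow> (\<lambda>t. pt e x u) \<in> pt_curves e A B"
  unfolding pt_curves_def by (intro CollectI exI[of _ "\<lambda>t. x"] exI[of _ "\<lambda>t. u"]) simp

lemma bounded_pt_curves:
  fixes e :: "'n::finite + 'n \<Rightarrow> 'm::finite"
  assumes "I \<in> rat_intervals" and A: "A \<subseteq> C_ball I j" "A \<noteq> {}" and B: "B \<subseteq> C_ball I k" "B \<noteq> {}"
  shows "bounded_pair (I, pt_curves e A B)"
proof -
  have "pt_curves e A B \<subseteq> C_ball I (CARD('m) * (j + k))"
  proof
    fix \<gamma> assume "\<gamma> \<in> pt_curves e A B"
    then obtain x u where \<gamma>: "\<gamma> = (\<lambda>t. pt e (x t) (u t))" "x \<in> C_ball I j" "u \<in> C_ball I k"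
      using A B by (auto simp: pt_curves_def)
    have "norm (pt e (x t) (u t)) \<le> real (CARD('m) * (j + k))" if "t \<in> I" for t
    proof -
      have "norm (x t) + norm (u t) \<le> real (j + k)"
        using \<gamma>(2,3) that by (force simp: C_ball_def)
      then have "real CARD('m) * (norm (x t) + norm (u t)) \<le> real CARD('m) * real (j + k)"
        by (intro mult_left_mono) auto
      from order_trans[OF norm_pt_le this] show ?thesis by simp
    qed
    with \<gamma> show "\<gamma> \<in> C_ball I (CARD('m) * (j + k))"
      unfolding C_ball_def by (auto intro!: continuous_on_pt)
  qed
  moreover have "pt_curves e A B \<noteq> {}"
    using A(2) B(2) by (auto simp: pt_curves_def)
  ultimately show ?thesis
    using assms(1) by (auto simp: bounded_pair_def)
qed

lemma equicontinuous_pt_curves: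
  fixes e :: "'n::finite + 'n \<Rightarrow> 'm::finite"
  assumes A: "equicontinuous_pair (I, A)" and B: "equicontinuous_pair (I, B)"
  shows "equicontinuous_pair (I, pt_curves e A B)"
  unfolding equicontinuous_pair_def fst_conv snd_conv
proof (intro allI impI)
  fix \<epsilon> :: real assume "\<epsilon> > 0"
  define r where "r = \<epsilon> / (2 * real CARD('m))"
  have "r > 0" using \<open>\<epsilon> > 0\<close> by (simp add: r_def)
  obtain d1 where d1: "d1 > 0" "\<forall>\<gamma>\<in>A. \<forall>s\<in>I. \<forall>t\<in>I. \<bar>t - s\<bar> < d1 \<longrightarrow> norm (\<gamma> t - \<gamma> s) \<le> r"
    using A \<open>r > 0\<close> unfolding equicontinuous_pair_def fst_conv snd_conv by metis
  obtain d2 where d2: "d2 > 0" "\<forall>\<gamma>\<in>B. \<forall>s\<in>I. \<forall>t\<in>I. \<bar>t - s\<bar> < d2 \<longrightarrow> norm (\<gamma> t - \<gamma> s) \<le> r"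
    using B \<open>r > 0\<close> unfolding equicontinuous_pair_def fst_conv snd_conv by metis
  show "\<exists>\<delta>>0. \<forall>\<gamma>\<in>pt_curves e A B. \<forall>s\<in>I. \<forall>t\<in>I. \<bar>t - s\<bar> < \<delta> \<longrightarrow> norm (\<gamma> t - \<gamma> s) \<le> \<epsilon>"
  proof (intro exI[of _ "min d1 d2"] conjI ballI impI)
    fix \<gamma> s t assume g: "\<gamma> \<in> pt_curves e A B" and st: "s \<in> I" "t \<in> I" "\<bar>t - s\<bar> < min d1 d2"
    obtain x u where \<gamma>: "\<gamma> = (\<lambda>t. pt e (x t) (u t))" "x \<in> A" "u \<in> B"
      using g by (auto simp: pt_curves_def)
    have "norm (x t - x s) \<le> r" "norm (u t - u s) \<le> r"
      using d1(2) d2(2) \<gamma>(2,3) st by auto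
    then have "real CARD('m) * (norm (x t - x s) + norm (u t - u s)) \<le> real CARD('m) * (r + r)"
      by (intro mult_left_mono add_mono) auto
    also have "\<dots> = \<epsilon>" by (simp add: r_def)
    finally show "norm (\<gamma> t - \<gamma> s) \<le> \<epsilon>"
      unfolding \<gamma>(1) pt_diff using norm_pt_le[of e "x t - x s" "u t - u s"] by linarith
  qed (use d1(1) d2(1) in auto)
qed

lemma curves_Theta_D_eq:
  "curves_Theta_D e \<theta> D' = {(I, pt_curves e (K_mod \<theta> I j) {\<lambda>t. u}) | I j u. I \<in> rat_intervals \<and> u \<in> D'}"
proof -
  have "{\<lambda>t. pt e (x t) u | x. x \<in> A} = pt_curves e A {\<lambda>t. u}" for A u
    by (auto simp: pt_curves_def)
  then show ?thesis by (simp only: curves_Theta_D_def)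
qed

lemma pt_curves_shift:
  "{\<lambda>t. pt e (x t) (u (t - 1)) | x u. x \<in> A \<and> u \<in> B} = pt_curves e A ((\<lambda>u t. u (t - 1)) ` B)"
  unfolding pt_curves_def
proof (intro equalityI subsetI)
  fix \<gamma> assume "\<gamma> \<in> {\<lambda>t. pt e (x t) (u (t - 1)) | x u. x \<in> A \<and> u \<in> B}"
  then obtain x u where "\<gamma> = (\<lambda>t. pt e (x t) (u (t - 1)))" "x \<in> A" "u \<in> B" by blast
  then show "\<gamma> \<in> {\<lambda>t. pt e (x t) (u t) | x u. x \<in> A \<and> u \<in> (\<lambda>u t. u (t - 1)) ` B}"
    by (intro CollectI exI[of _ x] exI[of _ "\<lambda>t. u (t - 1)"]) simp
qed auto

lemma curves_Theta_Theta_eq: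
  "curves_Theta_Theta e \<theta> \<theta>' =
    {(I, pt_curves e (K_mod \<theta> I j) ((\<lambda>u t. u (t - 1)) ` K_mod \<theta>' (shift_back I) j)) | I j. I \<in> rat_intervals}"
  by (simp only: curves_Theta_Theta_def pt_curves_shift)

lemma curves_Theta_B_eq:
  "curves_Theta_B e \<theta> =
    {(I, pt_curves e (K_mod \<theta> I j) ((\<lambda>u t. u (t - 1)) ` C_ball (shift_back I) j)) | I j. I \<in> rat_intervals}"
  by (simp only: curves_Theta_B_def pt_curves_shift)

section \<open>Verification of the conditions for each listed family\<close>

lemma dense_constantsI:
  assumes "closure D = UNIV"
    and "\<And>I x. I \<in> rat_intervals \<Longrightarrow> x \<in> D \<Longrightarrow> \<exists>\<Gamma>. (I, \<Gamma>) \<in> \<C> \<and> (\<lambda>t. x) \<in> \<Gamma>"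
  shows "dense_constants \<C>"
  using assms unfolding dense_constants_def by (intro exI[of _ D]) simp

lemma bounded_pairI: "I \<in> rat_intervals \<Longrightarrow> \<Gamma> \<noteq> {} \<Longrightarrow> \<Gamma> \<subseteq> C_ball I j \<Longrightarrow> bounded_pair (I, \<Gamma>)"
  by (auto simp: bounded_pair_def)

lemma C_ball_nonempty: "C_ball I j \<noteq> {}"
  using const_in_C_ball[of 0 j I] by auto

lemma K_mod_nonempty:
  assumes "suitable_moduli \<theta>" "I \<in> rat_intervals"
  shows "(K_mod \<theta> I j :: (real \<Rightarrow> 'a::real_normed_vector) set) \<noteq> {}"
  using const_in_K_mod[OF assms, of "0::'a" j] by auto

lemma admissible_curves_B:
  shows "dense_constants curves_B" "\<forall>c\<in>curves_B. bounded_pair c"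
proof -
  show "dense_constants curves_B"
    by (rule dense_constantsI[of UNIV])
      (auto simp: curves_B_def intro!: exI[of _ "C_ball _ _"] const_in_C_ball norm_le_nat)
  show "\<forall>c\<in>curves_B. bounded_pair c"
    by (auto simp: curves_B_def intro!: bounded_pairI C_ball_nonempty)
qed

lemma admissible_curves_D:
  assumes "closure D = UNIV"
  shows "dense_constants (curves_D D)" "\<forall>c\<in>curves_D D. bounded_pair c \<and> equicontinuous_pair c"
proof -
  show "dense_constants (curves_D D)"
    by (rule dense_constantsI[OF assms]) (auto simp: curves_D_def)
  show "\<forall>c\<in>curves_D D. bounded_pair c \<and> equicontinuous_pair c"
    by (auto simp: curves_D_def equicontinuous_const intro!: bounded_pairI const_in_C_ball norm_le_nat)
qed

lemma admissible_curves_Theta: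
  assumes "suitable_moduli \<theta>"
  shows "dense_constants (curves_Theta \<theta>)" "\<forall>c\<in>curves_Theta \<theta>. bounded_pair c \<and> equicontinuous_pair c"
proof -
  show "dense_constants (curves_Theta \<theta>)"
    by (rule dense_constantsI[of UNIV])
      (auto simp: curves_Theta_def intro!: exI[of _ "K_mod _ _ _"] const_in_K_mod[OF assms] norm_le_nat)
  show "\<forall>c\<in>curves_Theta \<theta>. bounded_pair c \<and> equicontinuous_pair c"
    by (auto simp: curves_Theta_def intro!: bounded_pairI[OF _ K_mod_nonempty K_mod_subset_C_ball]
        equicontinuous_K_mod assms)
qed

text \<open>The first component of a constant is free, because every \<open>x\<close> lies in
  \<open>K_mod \<theta> I j\<close> for large \<open>j\<close>; hence the dense set consists of all
  pairs with second component in \<open>D'\<close>.\<close>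

lemma admissible_curves_Theta_D:
  assumes e: "bij e" and th: "suitable_moduli \<theta>" and D': "closure D' = UNIV"
  shows "dense_constants (curves_Theta_D e \<theta> D')"
    "\<forall>c\<in>curves_Theta_D e \<theta> D'. bounded_pair c \<and> equicontinuous_pair c"
proof -
  show "dense_constants (curves_Theta_D e \<theta> D')"
  proof (rule dense_constantsI[of "{pt e x u | x u. u \<in> D'}"])
    have "z \<in> closure {pt e x u | x u. u \<in> D'}" for z
    proof -
      obtain x u where z: "z = pt e x u" using pt_surj[OF e] by blast
      have "continuous_on UNIV (\<lambda>u. pt e x u)"
      proof -
        have "continuous_on I (\<lambda>u. case inv e i of Inl k \<Rightarrow> x $ k | Inr k \<Rightarrow> u $ k)" for i I
          by (cases "inv e i") (auto intro!: continuous_intros)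
        then show ?thesis unfolding pt_def by (rule continuous_on_vec_lambda)
      qed
      \<comment> \<open>Density is checked with \<open>x\<close> fixed: continuity in
        \<open>u\<close> alone carries \<open>closure D'\<close> into the closure of the slice over
        \<open>x\<close>.\<close>
      then have "(\<lambda>u. pt e x u) ` closure D' \<subseteq> closure ((\<lambda>u. pt e x u) ` D')"
        by (intro image_closure_subset) (auto intro: continuous_on_subset closure_subset[THEN subsetD])
      also have "\<dots> \<subseteq> closure {pt e x u | x u. u \<in> D'}"
        by (intro closure_mono) auto
      finally show ?thesis using D' z by auto
    qed
    then show "closure {pt e x u | x u. u \<in> D'} = UNIV" by blast
    fix I z assume I: "I \<in> rat_intervals" and "z \<in> {pt e x u | x u. u \<in> D'}"
    then obtain x u where z: "z = pt e x u" "u \<in> D'" by blast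
    have "(\<lambda>t. z) \<in> pt_curves e (K_mod \<theta> I (nat \<lceil>norm x\<rceil>)) {\<lambda>t. u}"
      unfolding z(1) by (intro pt_curvesI const_in_K_mod[OF th I] norm_le_nat) simp
    then show "\<exists>\<Gamma>. (I, \<Gamma>) \<in> curves_Theta_D e \<theta> D' \<and> (\<lambda>t. z) \<in> \<Gamma>"
      unfolding curves_Theta_D_eq using I z(2) by blast
  qed
  show "\<forall>c\<in>curves_Theta_D e \<theta> D'. bounded_pair c \<and> equicontinuous_pair c"
  proof
    fix c assume "c \<in> curves_Theta_D e \<theta> D'"
    then obtain I j u where c: "c = (I, pt_curves e (K_mod \<theta> I j) {\<lambda>t. u})" "I \<in> rat_intervals"
      unfolding curves_Theta_D_eq by blast
    have "{\<lambda>t. u} \<subseteq> C_ball I (nat \<lceil>norm u\<rceil>)"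
      using const_in_C_ball[OF norm_le_nat, of u I] by simp
    then show "bounded_pair c \<and> equicontinuous_pair c"
      unfolding c(1) using bounded_pt_curves[OF c(2) K_mod_subset_C_ball K_mod_nonempty[OF th c(2)]]
        equicontinuous_pt_curves[OF equicontinuous_K_mod[OF th c(2)] equicontinuous_const]
      by blast
  qed
qed

text \<open>Leaving the second set of curves open as \<open>B\<close> treats moduli of continuity
  and full balls of continuous functions together; \<open>B\<close> must lie in the balls and
  contain the constants.\<close>

lemma admissible_curves_Theta_shift:
  fixes B :: "real set \<Rightarrow> nat \<Rightarrow> (real \<Rightarrow> real^'n) set" and e :: "'n::finite + 'n \<Rightarrow> 'm::finite"
  defines "\<C> \<theta> \<equiv> {(I, pt_curves e (K_mod \<theta> I j) ((\<lambda>u t. u (t - 1)) ` B (shift_back I) j)) | I j. I \<in> rat_intervals}"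
  assumes e: "bij e" and th: "suitable_moduli \<theta>"
    and B: "\<And>I j. I \<in> rat_intervals \<Longrightarrow> B I j \<subseteq> C_ball I j"
      "\<And>I j x. I \<in> rat_intervals \<Longrightarrow> norm x \<le> real j \<Longrightarrow> (\<lambda>t. x) \<in> B I j"
  shows "dense_constants (\<C> \<theta>)" "\<forall>c\<in>\<C> \<theta>. bounded_pair c"
proof -
  show "dense_constants (\<C> \<theta>)"
  proof (rule dense_constantsI[of UNIV])
    fix I and z :: "real^'m" assume I: "I \<in> rat_intervals"
    obtain x u where z: "z = pt e x u" using pt_surj[OF e] by blast
    \<comment> \<open>Both components carry the same index \<open>j\<close> in these families, so
      the larger one is taken.\<close>
    define j where "j = max (nat \<lceil>norm x\<rceil>) (nat \<lceil>norm u\<rceil>)"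
    have j: "norm x \<le> real j" "norm u \<le> real j"
      unfolding j_def of_nat_max
      by (rule max.coboundedI1[OF norm_le_nat], rule max.coboundedI2[OF norm_le_nat])
    have "(\<lambda>t. u) \<in> (\<lambda>u t. u (t - 1)) ` B (shift_back I) j"
      using B(2)[OF shift_back_rat_intervals[OF I] j(2)] by (rule rev_image_eqI) simp
    then have "(\<lambda>t. z) \<in> pt_curves e (K_mod \<theta> I j) ((\<lambda>u t. u (t - 1)) ` B (shift_back I) j)"
      unfolding z by (intro pt_curvesI const_in_K_mod[OF th I j(1)])
    then show "\<exists>\<Gamma>. (I, \<Gamma>) \<in> \<C> \<theta> \<and> (\<lambda>t. z) \<in> \<Gamma>"
      unfolding \<C>_def using I by blast
  qed simp
  show "\<forall>c\<in>\<C> \<theta>. bounded_pair c"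
  proof
    fix c assume "c \<in> \<C> \<theta>"
    then obtain I j where c: "c = (I, pt_curves e (K_mod \<theta> I j) ((\<lambda>u t. u (t - 1)) ` B (shift_back I) j))"
      "I \<in> rat_intervals"
      unfolding \<C>_def by blast
    note I' = shift_back_rat_intervals[OF c(2)]
    have "(\<lambda>u t. u (t - 1)) ` B (shift_back I) j \<subseteq> C_ball I j"
      using B(1)[OF I', of j] by (intro image_subsetI shifted_curve_in_C_ball) blast
    moreover have "(\<lambda>u t. u (t - 1)) ` B (shift_back I) j \<noteq> {}"
      using B(2)[OF I', of 0 j] by auto
    ultimately show "bounded_pair c"
      unfolding c(1) by (rule bounded_pt_curves[OF c(2) K_mod_subset_C_ball K_mod_nonempty[OF th c(2)]])
  qed
qed

lemma admissible_curves_Theta_Theta: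
  assumes e: "bij e" and th: "suitable_moduli \<theta>" and th': "suitable_moduli \<theta>'"
  shows "dense_constants (curves_Theta_Theta e \<theta> \<theta>')"
    "\<forall>c\<in>curves_Theta_Theta e \<theta> \<theta>'. bounded_pair c \<and> equicontinuous_pair c"
proof -
  note * = admissible_curves_Theta_shift[OF e th, of "K_mod \<theta>'", OF K_mod_subset_C_ball const_in_K_mod[OF th']]
  show "dense_constants (curves_Theta_Theta e \<theta> \<theta>')"
    unfolding curves_Theta_Theta_eq by (rule *(1))
  have "equicontinuous_pair c" if "c \<in> curves_Theta_Theta e \<theta> \<theta>'" for c
  proof -
    from that obtain I j where c: "c = (I, pt_curves e (K_mod \<theta> I j) ((\<lambda>u t. u (t - 1)) ` K_mod \<theta>' (shift_back I) j))"
      "I \<in> rat_intervals"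
      unfolding curves_Theta_Theta_eq by blast
    show ?thesis
      unfolding c(1) by (intro equicontinuous_pt_curves equicontinuous_shift equicontinuous_K_mod th th' c(2) shift_back_rat_intervals)
  qed
  moreover have "\<forall>c\<in>curves_Theta_Theta e \<theta> \<theta>'. bounded_pair c"
    unfolding curves_Theta_Theta_eq by (rule *(2))
  ultimately show "\<forall>c\<in>curves_Theta_Theta e \<theta> \<theta>'. bounded_pair c \<and> equicontinuous_pair c" by blast
qed

lemma admissible_curves_Theta_B:
  assumes e: "bij e" and th: "suitable_moduli \<theta>"
  shows "dense_constants (curves_Theta_B e \<theta>)" "\<forall>c\<in>curves_Theta_B e \<theta>. bounded_pair c"
proof -
  note * = admissible_curves_Theta_shift[OF e th, of C_ball, OF subset_refl const_in_C_ball]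
  show "dense_constants (curves_Theta_B e \<theta>)"
    unfolding curves_Theta_B_eq by (rule *(1))
  show "\<forall>c\<in>curves_Theta_B e \<theta>. bounded_pair c"
    unfolding curves_Theta_B_eq by (rule *(2))
qed

section \<open>Agreement of all topologies within each list\<close>

theorem theorem2p20:
  fixes E :: "(real \<times> (real^'m) \<Rightarrow> real^'n) set set"
    and e :: "'n + 'n \<Rightarrow> 'm"
    and p :: nat
    and \<theta> \<theta>' :: "real set \<Rightarrow> nat \<Rightarrow> real \<Rightarrow> real"
    and D :: "(real^'m) set"
    and D' :: "(real^'n) set"
  assumes "p \<ge> 1"
    and "E \<subseteq> LC p"
    and "suitable_moduli \<theta>" and "suitable_moduli \<theta>'"
    and "\<forall>I\<in>rat_intervals. \<forall>j. \<forall>s\<ge>0. \<theta> I j s \<le> \<theta>' I j s"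
    and "countable D" and "closure D = UNIV"
    and "countable D'" and "closure D' = UNIV"
  shows "(Lq_loc_bounded_lbounds p E \<longrightarrow>
            (\<forall>T1\<in>strong_topologies e p \<theta> \<theta>' D D'. \<forall>T2\<in>strong_topologies e p \<theta> \<theta>' D D'.
               subtopology T1 E = subtopology T2 E \<and> T1 closure_of E = T2 closure_of E)) \<and>
         (Lq_loc_bounded_lbounds 1 E \<longrightarrow>
            (\<forall>T1\<in>weak_topologies e \<theta> \<theta>' D D'. \<forall>T2\<in>weak_topologies e \<theta> \<theta>' D D'.
               subtopology T1 E = subtopology T2 E \<and> T1 closure_of E = T2 closure_of E))"
proof -
  have "LC_fun p \<subseteq> (SC_fun p :: (real \<times> (real^'m) \<Rightarrow> real^'n) set)"
    by (rule subsetI) (simp add: LC_fun_def)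
  then have "LC p \<subseteq> (SC p :: (real \<times> (real^'m) \<Rightarrow> real^'n) set set)"
    unfolding LC_def SC_def by (rule image_mono)
  with assms(2) have E: "E \<subseteq> SC p" by (rule order_trans)
  \<comment> \<open>The weak topologies live on \<open>SC 1\<close> whatever the exponent of
    \<open>E\<close> is.\<close>
  have E1: "E \<subseteq> SC 1" using E SC_subset_1[OF assms(1)] by (rule subset_trans)
  \<comment> \<open>From here on a topology of the list is known only as one generated by a family
    meeting the conditions; each hybrid case brings \<open>bij e\<close> with it.\<close>
  have strong: "\<exists>\<C>. T = strong_topology p \<C> \<and> dense_constants \<C> \<and> (\<forall>c\<in>\<C>. bounded_pair c)"
    if "T \<in> strong_topologies e p \<theta> \<theta>' D D'" for T
  proof -
    from that[unfolded strong_topologies_def] obtain \<C> where \<C>: "T = strong_topology p \<C>"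
      "\<C> \<in> {curves_B, curves_D D, curves_Theta \<theta>} \<union>
        (if bij e then {curves_Theta_D e \<theta> D', curves_Theta_Theta e \<theta> \<theta>', curves_Theta_Theta e \<theta> \<theta>,
           curves_Theta_B e \<theta>} else {})"
      by (rule imageE)
    from \<C>(2) consider "\<C> = curves_B" | "\<C> = curves_D D" | "\<C> = curves_Theta \<theta>"
      | "bij e" "\<C> = curves_Theta_D e \<theta> D'" | "bij e" "\<C> = curves_Theta_Theta e \<theta> \<theta>'"
      | "bij e" "\<C> = curves_Theta_Theta e \<theta> \<theta>" | "bij e" "\<C> = curves_Theta_B e \<theta>"
      by (simp split: if_split_asm; metis)
    then have "dense_constants \<C> \<and> (\<forall>c\<in>\<C>. bounded_pair c)"
    proof cases
      case 1 then show ?thesis by (simp add: admissible_curves_B)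
    next
      case 2 then show ?thesis by (simp add: admissible_curves_D[OF assms(7)])
    next
      case 3 then show ?thesis by (simp add: admissible_curves_Theta[OF assms(3)])
    next
      case 4 then show ?thesis by (simp add: admissible_curves_Theta_D[OF 4(1) assms(3,9)])
    next
      case 5 then show ?thesis by (simp add: admissible_curves_Theta_Theta[OF 5(1) assms(3,4)])
    next
      case 6 then show ?thesis by (simp add: admissible_curves_Theta_Theta[OF 6(1) assms(3,3)])
    next
      case 7 then show ?thesis by (simp add: admissible_curves_Theta_B[OF 7(1) assms(3)])
    qed
    with \<C>(1) show ?thesis by (intro exI conjI[of "_ = _"])
  qed
  have weak: "\<exists>\<C>. T = weak_topology \<C> \<and> dense_constants \<C> \<and> (\<forall>c\<in>\<C>. bounded_pair c \<and> equicontinuous_pair c)"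
    if "T \<in> weak_topologies e \<theta> \<theta>' D D'" for T
  proof -
    from that[unfolded weak_topologies_def] obtain \<C> where \<C>: "T = weak_topology \<C>"
      "\<C> \<in> {curves_D D, curves_Theta \<theta>} \<union>
        (if bij e then {curves_Theta_D e \<theta> D', curves_Theta_Theta e \<theta> \<theta>', curves_Theta_Theta e \<theta> \<theta>} else {})"
      by (rule imageE)
    from \<C>(2) consider "\<C> = curves_D D" | "\<C> = curves_Theta \<theta>"
      | "bij e" "\<C> = curves_Theta_D e \<theta> D'" | "bij e" "\<C> = curves_Theta_Theta e \<theta> \<theta>'"
      | "bij e" "\<C> = curves_Theta_Theta e \<theta> \<theta>"
      by (simp split: if_split_asm; metis)
    then have "dense_constants \<C> \<and> (\<forall>c\<in>\<C>. bounded_pair c \<and> equicontinuous_pair c)"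
    proof cases
      case 1 then show ?thesis by (simp add: admissible_curves_D[OF assms(7)])
    next
      case 2 then show ?thesis by (simp add: admissible_curves_Theta[OF assms(3)])
    next
      case 3 then show ?thesis by (simp add: admissible_curves_Theta_D[OF 3(1) assms(3,9)])
    next
      case 4 then show ?thesis by (simp add: admissible_curves_Theta_Theta[OF 4(1) assms(3,4)])
    next
      case 5 then show ?thesis by (simp add: admissible_curves_Theta_Theta[OF 5(1) assms(3,3)])
    qed
    with \<C>(1) show ?thesis by (intro exI conjI[of "_ = _"])
  qed
  show ?thesis
  proof (intro conjI impI ballI)
    fix T1 T2 assume l: "Lq_loc_bounded_lbounds p E"
      and T: "T1 \<in> strong_topologies e p \<theta> \<theta>' D D'" "T2 \<in> strong_topologies e p \<theta> \<theta>' D D'"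
    obtain \<C>1 where C1: "T1 = strong_topology p \<C>1" "dense_constants \<C>1" "\<forall>c\<in>\<C>1. bounded_pair c"
      using strong[OF T(1)] by blast
    obtain \<C>2 where C2: "T2 = strong_topology p \<C>2" "dense_constants \<C>2" "\<forall>c\<in>\<C>2. bounded_pair c"
      using strong[OF T(2)] by blast
    show "subtopology T1 E = subtopology T2 E" "T1 closure_of E = T2 closure_of E"
      unfolding C1(1) C2(1) by (rule strong_topologies_agree[OF assms(1) E l C1(2,3) C2(2,3)])+
  next
    fix T1 T2 assume l: "Lq_loc_bounded_lbounds 1 E"
      and T: "T1 \<in> weak_topologies e \<theta> \<theta>' D D'" "T2 \<in> weak_topologies e \<theta> \<theta>' D D'"
    obtain \<C>1 where C1: "T1 = weak_topology \<C>1" "dense_constants \<C>1"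
      "\<forall>c\<in>\<C>1. bounded_pair c \<and> equicontinuous_pair c"
      using weak[OF T(1)] by blast
    obtain \<C>2 where C2: "T2 = weak_topology \<C>2" "dense_constants \<C>2"
      "\<forall>c\<in>\<C>2. bounded_pair c \<and> equicontinuous_pair c"
      using weak[OF T(2)] by blast
    show "subtopology T1 E = subtopology T2 E" "T1 closure_of E = T2 closure_of E"
      unfolding C1(1) C2(1) by (rule weak_topologies_agree[OF E1 l C1(2,3) C2(2,3)])+
  qed
qed

end
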